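(* For every $x\in\mathbb S$, the transition rate $q_{x\infty}=\lim_{t\searrow 0}\frac{p_{x\infty}(t)}{t}$ exists and $$q_{x\infty}=\begin{cases}\frac{1}{\gamma_x}&\text{if }c>0,\\ 0&\text{if }c=0.\end{cases}$$
   Context: Let $\mathbb S$ be a countably infinite set, $\infty$ a symbol not in $\mathbb S$, and $\bar{\mathbb S}=\mathbb S\cup\{\infty\}$. The parameters are strictly positive reals $\{\gamma_x,\lambda_x:x\in\mathbb S\}$ and a constant $c\ge 0$, with $\sum_{x\in\mathbb S}\lambda_x=\infty$ and $\sum_{x\in\mathbb S}\lambda_x\gamma_x<\infty$; set $\gamma_\infty=0$. On a probability space $(\Omega,\mathcal F,\mathbb P)$ let the following be independent: a family $\{N_x:x\in\mathbb S\}$ of independent Poisson processes on $\mathbb R^+$, $N_x$ of rate $\lambda_x$ with marks $0<\sigma^x_1<\sigma^x_2<\cdots$ ($N_x(t)$ is the number of marks in $[0,t]$), and a family $\{T_0\}\cup\{T^x_n:n\ge 1,x\in\mathbb S\}$ of i.i.d. exponential random variables of rate $1$. Clock process: for $y\in\bar{\mathbb S}$, $t\ge 0$, $\Gamma^y(t)=\gamma_yT_0+\sum_{z\in\mathbb S}\sum_{i=1}^{N_z(t)}\gamma_zT^z_i+ct$ (empty sums are $0$), and $\Gamma^y(s-)$ denotes its left limit at $s$. K process with initial state $y\in\bar{\mathbb S}$: $X^y(t)=y$ if $t<\gamma_yT_0$; $X^y(t)=x$ (with $x\in\mathbb S$) if $t\in\bigcup_{i\ge 1}[\Gamma^y(\sigma^x_i-),\Gamma^y(\sigma^x_i))$;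 $X^y(t)=\infty$ otherwise. Transition functions: $p_{xy}(t)=\mathbb P(X^x(t)=y)$ for $x,y\in\bar{\mathbb S}$, $t\ge 0$. *)

theory Defs
  imports "HOL-Probability.Probability"
begin

text \<open>
  The countably infinite set of states is the whole of a type \<open>'s\<close>, and the extended state space
  is \<open>'s option\<close>, with \<open>None\<close> for the extra point \<open>\<infinity>\<close>. Marks and holding times are
  indexed from 1: \<open>\<sigma> x n\<close> and \<open>T x n\<close> are only meaningful for \<open>n \<ge> 1\<close>.
\<close>

definition mark_count :: "(nat \<Rightarrow> 'w \<Rightarrow> real) \<Rightarrow> real \<Rightarrow> 'w \<Rightarrow> nat" where
  "mark_count \<sigma> t \<omega> = card {n. 1 \<le> n \<and> \<sigma> n \<omega> \<le> t}"

text \<open>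
  The increment condition uses truncated subtraction on \<^typ>\<open>nat\<close>, which is harmless because
  \<open>mark_count \<sigma>\<close> is nondecreasing in time, the marks being locally finite.
\<close>

definition poisson_process_with_marks ::
    "'w measure \<Rightarrow> real \<Rightarrow> (nat \<Rightarrow> 'w \<Rightarrow> real) \<Rightarrow> bool" where
  "poisson_process_with_marks M r \<sigma> \<longleftrightarrow>
     (\<forall>\<omega>\<in>space M. 0 < \<sigma> 1 \<omega> \<and> (\<forall>n\<ge>1. \<sigma> n \<omega> < \<sigma> (Suc n) \<omega>)
        \<and> (\<forall>t. finite {n. 1 \<le> n \<and> \<sigma> n \<omega> \<le> t})) \<and>
     (\<forall>t\<ge>0. mark_count \<sigma> t \<in> measurable M (count_space UNIV)) \<and>
     (\<forall>s t. 0 \<le> s \<and> s < t \<longrightarrow>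
        distr M (count_space UNIV) (\<lambda>\<omega>. mark_count \<sigma> t \<omega> - mark_count \<sigma> s \<omega>)
          = measure_pmf (poisson_pmf (r * (t - s)))) \<and>
     (\<forall>(k::nat) \<tau>. 0 \<le> \<tau> 0 \<and> (\<forall>i<k. \<tau> i < \<tau> (Suc i)) \<longrightarrow>
        prob_space.indep_vars M (\<lambda>_. count_space UNIV)
          (\<lambda>i \<omega>. mark_count \<sigma> (\<tau> (Suc i)) \<omega> - mark_count \<sigma> (\<tau> i) \<omega>) {..<k})"

text \<open>
  The family \<open>{T\<^sub>0} \<union> {T x n | n \<ge> 1}\<close> as one indexed family, \<open>T\<^sub>0\<close> sitting at index \<open>None\<close>.
\<close>

definition exp_index :: "('s \<times> nat) option set" where
  "exp_index = insert None (Some ` (UNIV \<times> {1..}))"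

definition exp_family ::
    "('w \<Rightarrow> real) \<Rightarrow> ('s \<Rightarrow> nat \<Rightarrow> 'w \<Rightarrow> real) \<Rightarrow> ('s \<times> nat) option \<Rightarrow> 'w \<Rightarrow> real" where
  "exp_family T0 T j = (case j of None \<Rightarrow> T0 | Some (x, n) \<Rightarrow> T x n)"

abbreviation path_space :: "(real \<Rightarrow> nat) measure" where
  "path_space \<equiv> Pi\<^sub>M {0..} (\<lambda>_. count_space UNIV)"

definition mark_path :: "(nat \<Rightarrow> 'w \<Rightarrow> real) \<Rightarrow> 'w \<Rightarrow> real \<Rightarrow> nat" where
  "mark_path \<sigma> \<omega> = (\<lambda>t\<in>{0..}. mark_count \<sigma> t \<omega>)"

locale K_process_data = prob_space M
  for M :: "'w measure"
    and \<gamma> :: "'s::countable \<Rightarrow> real" and rate :: "'s \<Rightarrow> real" and c :: real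
    and \<sigma> :: "'s \<Rightarrow> nat \<Rightarrow> 'w \<Rightarrow> real"
    and T0 :: "'w \<Rightarrow> real" and T :: "'s \<Rightarrow> nat \<Rightarrow> 'w \<Rightarrow> real" +
  assumes infinite_states: "infinite (UNIV :: 's set)"
    and gamma_pos: "\<And>x. 0 < \<gamma> x"
    and rate_pos: "\<And>x. 0 < rate x"
    and c_nonneg: "0 \<le> c"
    and rate_sum_infinite: "\<not> rate summable_on UNIV"
    and rate_gamma_summable: "(\<lambda>x. rate x * \<gamma> x) summable_on UNIV"
    and poisson: "\<And>x. poisson_process_with_marks M (rate x) (\<sigma> x)"
    and poisson_indep: "indep_vars (\<lambda>_. path_space) (\<lambda>x. mark_path (\<sigma> x)) UNIV"
    and exp_distributed:
      "\<And>j. j \<in> exp_index \<Longrightarrow> distributed M lborel (exp_family T0 T j) (exponential_density 1)"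
    and exp_indep: "indep_vars (\<lambda>_. borel) (exp_family T0 T) exp_index"
    and families_indep:
      "indep_set
         (sets (vimage_algebra (space M) (\<lambda>\<omega>. \<lambda>x\<in>UNIV. mark_path (\<sigma> x) \<omega>)
            (Pi\<^sub>M UNIV (\<lambda>_. path_space))))
         (sets (vimage_algebra (space M) (\<lambda>\<omega>. \<lambda>j\<in>exp_index. exp_family T0 T j \<omega>)
            (Pi\<^sub>M exp_index (\<lambda>_. borel))))"

definition gamma_ext :: "('s \<Rightarrow> real) \<Rightarrow> 's option \<Rightarrow> real" where
  "gamma_ext \<gamma> y = (case y of None \<Rightarrow> 0 | Some x \<Rightarrow> \<gamma> x)"

text \<open>
  The clock is a series of almost surely nonnegative terms, so it is given values in
  \<open>[0, \<infinity>]\<close>; it is almost surely finite. Negative values of the holding times, which occur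
  with probability 0, are truncated to 0 by \<^const>\<open>ennreal\<close>.
\<close>

definition clock ::
    "('s \<Rightarrow> real) \<Rightarrow> real \<Rightarrow> ('s \<Rightarrow> nat \<Rightarrow> 'w \<Rightarrow> real) \<Rightarrow> ('w \<Rightarrow> real) \<Rightarrow> ('s \<Rightarrow> nat \<Rightarrow> 'w \<Rightarrow> real)
      \<Rightarrow> 's option \<Rightarrow> real \<Rightarrow> 'w \<Rightarrow> ennreal" where
  "clock \<gamma> c \<sigma> T0 T y t \<omega> =
     ennreal (gamma_ext \<gamma> y * T0 \<omega>)
     + (\<Sum>\<^sub>\<infinity>z\<in>UNIV. \<Sum>i = 1..mark_count (\<sigma> z) t \<omega>. ennreal (\<gamma> z * T z i \<omega>))
     + ennreal (c * t)"

definition clock_left ::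
    "('s \<Rightarrow> real) \<Rightarrow> real \<Rightarrow> ('s \<Rightarrow> nat \<Rightarrow> 'w \<Rightarrow> real) \<Rightarrow> ('w \<Rightarrow> real) \<Rightarrow> ('s \<Rightarrow> nat \<Rightarrow> 'w \<Rightarrow> real)
      \<Rightarrow> 's option \<Rightarrow> real \<Rightarrow> 'w \<Rightarrow> ennreal" where
  "clock_left \<gamma> c \<sigma> T0 T y s \<omega> = Lim (at_left s) (\<lambda>u. clock \<gamma> c \<sigma> T0 T y u \<omega>)"

definition visit_times ::
    "('s \<Rightarrow> real) \<Rightarrow> real \<Rightarrow> ('s \<Rightarrow> nat \<Rightarrow> 'w \<Rightarrow> real) \<Rightarrow> ('w \<Rightarrow> real) \<Rightarrow> ('s \<Rightarrow> nat \<Rightarrow> 'w \<Rightarrow> real)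
      \<Rightarrow> 's option \<Rightarrow> 's \<Rightarrow> 'w \<Rightarrow> real set" where
  "visit_times \<gamma> c \<sigma> T0 T y x \<omega> =
     {t. \<exists>i\<ge>1. ennreal t \<in> {clock_left \<gamma> c \<sigma> T0 T y (\<sigma> x i \<omega>) \<omega> ..<
                             clock \<gamma> c \<sigma> T0 T y (\<sigma> x i \<omega>) \<omega>}}"

text \<open>
  Distinct Poisson processes almost surely have no common mark, hence the visit times of distinct
  states are almost surely disjoint and \<open>SOME\<close> picks the only candidate.
\<close>

definition K_process ::
    "('s \<Rightarrow> real) \<Rightarrow> real \<Rightarrow> ('s \<Rightarrow> nat \<Rightarrow> 'w \<Rightarrow> real) \<Rightarrow> ('w \<Rightarrow> real) \<Rightarrow> ('s \<Rightarrow> nat \<Rightarrow> 'w \<Rightarrow> real)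
      \<Rightarrow> 's option \<Rightarrow> real \<Rightarrow> 'w \<Rightarrow> 's option" where
  "K_process \<gamma> c \<sigma> T0 T y t \<omega> =
     (if t < gamma_ext \<gamma> y * T0 \<omega> then y
      else if \<exists>x. t \<in> visit_times \<gamma> c \<sigma> T0 T y x \<omega>
        then Some (SOME x. t \<in> visit_times \<gamma> c \<sigma> T0 T y x \<omega>)
      else None)"

definition transition_prob ::
    "'w measure \<Rightarrow> ('s \<Rightarrow> real) \<Rightarrow> real \<Rightarrow> ('s \<Rightarrow> nat \<Rightarrow> 'w \<Rightarrow> real) \<Rightarrow> ('w \<Rightarrow> real)
      \<Rightarrow> ('s \<Rightarrow> nat \<Rightarrow> 'w \<Rightarrow> real) \<Rightarrow> 's option \<Rightarrow> 's option \<Rightarrow> real \<Rightarrow> real" where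
  "transition_prob M \<gamma> c \<sigma> T0 T x y t =
     measure M {\<omega> \<in> space M. K_process \<gamma> c \<sigma> T0 T x t \<omega> = y}"

end

theory Submission
  imports Defs
begin

text \<open>
  Write \<open>\<Gamma>\<close> for the clock with initial state \<open>\<infinity>\<close>. Started at \<open>x\<close>, the process sits at \<open>x\<close> until
  time \<open>\<gamma>\<^sub>x T\<^sub>0\<close> and afterwards follows \<open>\<Gamma>\<close>, shifted by \<open>\<gamma>\<^sub>x T\<^sub>0\<close>. It is therefore at \<open>\<infinity>\<close> at time
  \<open>t\<close> exactly when \<open>\<gamma>\<^sub>x T\<^sub>0 \<le> t\<close> and \<open>t - \<gamma>\<^sub>x T\<^sub>0\<close> lies in the random set \<open>unvisited\<close> of those
  times that no jump interval of \<open>\<Gamma>\<close> covers (\<open>K_process_eq_None_iff_unvisited\<close>). Since \<open>T\<^sub>0\<close> is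
  exponential and independent of \<open>\<Gamma>\<close>, integrating it out gives, with \<open>E(t)\<close> the expected Lebesgue
  measure of \<open>unvisited\<close> within \<open>[0, t]\<close>, \<open>exp (- t / \<gamma>\<^sub>x) / \<gamma>\<^sub>x * E(t) \<le> p\<^sub>x\<^sub>\<infinity>(t) \<le> 1 / \<gamma>\<^sub>x *
  E(t)\<close>, which is \<open>None_probability_bounds\<close>. Everything thus depends on the behaviour of \<open>E(t)/t\<close>
  as \<open>t\<close> tends to \<open>0\<close>.

  Pathwise, \<open>\<Gamma>(r) = A(r) + c r\<close>, where \<open>A\<close> is purely discontinuous. Up to \<open>\<Gamma>(r)\<close> the jump
  intervals are disjoint and have total length \<open>A(r)\<close>, so what remains uncovered below \<open>\<Gamma>(r)\<close> has
  measure \<open>c r\<close> (\<open>emeasure_uncovered_by_jumps\<close>).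

  If \<open>c = 0\<close>, nothing remains below any finite value of \<open>\<Gamma>\<close>. Almost surely \<open>\<Gamma>\<close> is finite, because
  \<open>A(r)\<close> has mean \<open>r (\<Sum>\<^sub>z \<lambda>\<^sub>z \<gamma>\<^sub>z)\<close>, and unbounded, because the holding times of a single state
  already have infinite sum. Hence \<open>E(t) = 0\<close>.

  If \<open>c > 0\<close>, trivially \<open>E(t) \<le> t\<close>. Conversely let \<open>0 < \<theta> < 1\<close> and \<open>r = \<theta> t / c\<close>. On the event
  \<open>A(r) \<le> (1 - \<theta>) t\<close> one has \<open>\<Gamma>(r) \<le> t\<close>, so at least \<open>c r = \<theta> t\<close> of \<open>[0, t]\<close> is uncovered, and it
  remains to see that this event has probability tending to \<open>1\<close>, that is, that \<open>A(r)/r\<close> tends to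
  \<open>0\<close> in probability (\<open>prob_large_jumps_tendsto_0\<close>). The mean of \<open>A(r)/r\<close> does not tend to \<open>0\<close>;
  however, the state \<open>z\<close> contributes to \<open>P(A(r) > \<delta> r)\<close> at most \<open>min (\<lambda>\<^sub>z r) (\<lambda>\<^sub>z \<gamma>\<^sub>z / \<delta>)\<close>, by
  bounding either the probability that \<open>z\<close> is marked at all or the mean of its jumps. These bounds
  vanish with \<open>r\<close> for each \<open>z\<close> and are dominated by a summable family.
\<close>

section \<open>Countable sums and independent integrands\<close>

lemma nn_integral_count_space_eq_infsum:
  fixes f :: "'a::countable \<Rightarrow> ennreal"
  assumes "infinite (UNIV :: 'a set)"
  shows "(\<integral>\<^sup>+x. f x \<partial>count_space UNIV) = (\<Sum>\<^sub>\<infinity>x\<in>UNIV. f x)"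
proof -
  have bij: "bij_betw (from_nat_into (UNIV :: 'a set)) UNIV UNIV"
    using assms by (intro bij_betw_from_nat_into) auto
  have "(\<integral>\<^sup>+x. f x \<partial>count_space UNIV) = (\<integral>\<^sup>+n. f (from_nat_into UNIV n) \<partial>count_space UNIV)"
    using bij by (rule nn_integral_bij_count_space[symmetric])
  also have "\<dots> = (\<Sum>n. f (from_nat_into UNIV n))"
    by (rule nn_integral_count_space_nat)
  also have "\<dots> = (\<Sum>\<^sub>\<infinity>n\<in>UNIV. f (from_nat_into UNIV n))"
    by (intro sums_unique[symmetric] has_sum_imp_sums has_sum_infsum nonneg_summable_on_complete) auto
  also have "\<dots> = (\<Sum>\<^sub>\<infinity>x\<in>UNIV. f x)"
    by (rule infsum_reindex_bij_betw[OF bij])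
  finally show ?thesis .
qed

text \<open>
  This recovers the marks up to a given time from their number: they are the first ones.
\<close>

lemma downward_closed_eq_atLeastAtMost_card:
  fixes S :: "nat set"
  assumes fin: "finite S" and pos: "\<And>n. n \<in> S \<Longrightarrow> 1 \<le> n"
    and down: "\<And>m n. n \<in> S \<Longrightarrow> 1 \<le> m \<Longrightarrow> m \<le> n \<Longrightarrow> m \<in> S"
  shows "S = {1..card S}"
proof (cases "S = {}")
  case False
  have "{1..Max S} \<subseteq> S"
    using down[OF Max_in[OF fin False]] by auto
  moreover have "S \<subseteq> {1..Max S}"
    using pos Max_ge[OF fin] by auto
  ultimately have S: "S = {1..Max S}" by blast
  have "card S = card {1..Max S}" by (rule arg_cong[OF S])
  then show ?thesis using S by simp
qed auto

text \<open>
  The joint law of \<open>(X, Y)\<close> is the product of the marginal laws, so \<open>X\<close> may be integrated out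
  while \<open>Y\<close> is kept as a random variable. Independence is expressed through events because \<open>X\<close> and
  \<open>Y\<close> are allowed to have values of different types.
\<close>

lemma (in prob_space) nn_integral_independent:
  assumes X [measurable]: "X \<in> measurable M S" and Y [measurable]: "Y \<in> measurable M N"
    and indep: "\<And>A B. A \<in> sets S \<Longrightarrow> B \<in> sets N \<Longrightarrow>
      prob ((X -` A \<inter> space M) \<inter> (Y -` B \<inter> space M)) = prob (X -` A \<inter> space M) * prob (Y -` B \<inter> space M)"
    and F [measurable]: "case_prod F \<in> borel_measurable (S \<Otimes>\<^sub>M N)"
  shows "(\<integral>\<^sup>+\<omega>. F (X \<omega>) (Y \<omega>) \<partial>M) = (\<integral>\<^sup>+\<omega>. (\<integral>\<^sup>+x. F x (Y \<omega>) \<partial>distr M S X) \<partial>M)"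
proof -
  interpret X: prob_space "distr M S X" by (rule prob_space_distr) fact
  interpret Y: prob_space "distr M N Y" by (rule prob_space_distr) fact
  interpret pair_sigma_finite "distr M S X" "distr M N Y" ..
  have XY: "(\<lambda>\<omega>. (X \<omega>, Y \<omega>)) \<in> measurable M (S \<Otimes>\<^sub>M N)" by measurable
  have joint: "distr M S X \<Otimes>\<^sub>M distr M N Y = distr M (S \<Otimes>\<^sub>M N) (\<lambda>\<omega>. (X \<omega>, Y \<omega>))" (is "_ = ?J")
  proof (rule pair_measure_eqI)
    show "sigma_finite_measure (distr M S X)" "sigma_finite_measure (distr M N Y)" ..
    fix A B assume A: "A \<in> sets (distr M S X)" and B: "B \<in> sets (distr M N Y)"
    have "(\<lambda>\<omega>. (X \<omega>, Y \<omega>)) -` (A \<times> B) \<inter> space M = (X -` A \<inter> space M) \<inter> (Y -` B \<inter> space M)"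
      by auto
    then have "emeasure ?J (A \<times> B) = emeasure M ((X -` A \<inter> space M) \<inter> (Y -` B \<inter> space M))"
      using A B by (subst emeasure_distr[OF XY]) auto
    also have "\<dots> = emeasure M (X -` A \<inter> space M) * emeasure M (Y -` B \<inter> space M)"
      using indep[of A B] A B by (simp add: emeasure_eq_measure measure_nonneg ennreal_mult)
    also have "\<dots> = emeasure (distr M S X) A * emeasure (distr M N Y) B"
      using A B by (simp add: emeasure_distr)
    finally show "emeasure (distr M S X) A * emeasure (distr M N Y) B = emeasure ?J (A \<times> B)" by simp
  qed simp
  have "(\<integral>\<^sup>+\<omega>. F (X \<omega>) (Y \<omega>) \<partial>M) = (\<integral>\<^sup>+z. case_prod F z \<partial>?J)"
    by (subst nn_integral_distr[OF XY]) auto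
  also have "\<dots> = (\<integral>\<^sup>+z. case_prod F z \<partial>(distr M S X \<Otimes>\<^sub>M distr M N Y))"
    by (simp add: joint)
  also have "\<dots> = (\<integral>\<^sup>+y. (\<integral>\<^sup>+x. F x y \<partial>distr M S X) \<partial>distr M N Y)"
    by (subst nn_integral_snd[symmetric]) auto
  also have "\<dots> = (\<integral>\<^sup>+\<omega>. (\<integral>\<^sup>+x. F x (Y \<omega>) \<partial>distr M S X) \<partial>M)"
    by (subst nn_integral_distr) auto
  finally show ?thesis .
qed

lemma (in prob_space) nn_integral_mult_independent:
  fixes f :: "'b \<Rightarrow> ennreal" and g :: "'c \<Rightarrow> ennreal"
  assumes X [measurable]: "X \<in> measurable M S" and Y [measurable]: "Y \<in> measurable M N"
    and indep: "\<And>A B. A \<in> sets S \<Longrightarrow> B \<in> sets N \<Longrightarrow>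
      prob ((X -` A \<inter> space M) \<inter> (Y -` B \<inter> space M)) = prob (X -` A \<inter> space M) * prob (Y -` B \<inter> space M)"
    and f [measurable]: "f \<in> borel_measurable S" and g [measurable]: "g \<in> borel_measurable N"
  shows "(\<integral>\<^sup>+\<omega>. f (X \<omega>) * g (Y \<omega>) \<partial>M) = (\<integral>\<^sup>+\<omega>. f (X \<omega>) \<partial>M) * (\<integral>\<^sup>+\<omega>. g (Y \<omega>) \<partial>M)"
proof -
  have "(\<integral>\<^sup>+\<omega>. f (X \<omega>) * g (Y \<omega>) \<partial>M) = (\<integral>\<^sup>+\<omega>. (\<integral>\<^sup>+x. f x * g (Y \<omega>) \<partial>distr M S X) \<partial>M)"
    by (rule nn_integral_independent[OF X Y indep]) auto
  also have "\<dots> = (\<integral>\<^sup>+\<omega>. (\<integral>\<^sup>+x. f x \<partial>distr M S X) * g (Y \<omega>) \<partial>M)"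
    by (intro nn_integral_cong nn_integral_multc) auto
  also have "\<dots> = (\<integral>\<^sup>+x. f x \<partial>distr M S X) * (\<integral>\<^sup>+\<omega>. g (Y \<omega>) \<partial>M)"
    by (intro nn_integral_cmult) auto
  also have "(\<integral>\<^sup>+x. f x \<partial>distr M S X) = (\<integral>\<^sup>+\<omega>. f (X \<omega>) \<partial>M)"
    by (subst nn_integral_distr) auto
  finally show ?thesis .
qed

lemma borel_measurable_nn_integral_count_space:
  fixes f :: "'a \<Rightarrow> 'b \<Rightarrow> ennreal"
  assumes "countable I" and f: "\<And>i. i \<in> I \<Longrightarrow> f i \<in> borel_measurable N"
  shows "(\<lambda>x. \<integral>\<^sup>+i. f i x \<partial>count_space I) \<in> borel_measurable N"
proof -
  interpret sigma_finite_measure "count_space I"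
    by (rule sigma_finite_measure_count_space_countable) fact
  have "(\<lambda>z. f (snd z) (fst z)) \<in> borel_measurable (N \<Otimes>\<^sub>M count_space I)"
    by (rule measurable_compose_countable'[where f="\<lambda>i z. f i (fst z)" and g=snd and I=I])
       (auto intro: measurable_compose[OF measurable_fst f] \<open>countable I\<close>)
  then have "(\<lambda>(x, i). f i x) \<in> borel_measurable (N \<Otimes>\<^sub>M count_space I)"
    by (simp add: split_beta')
  then show ?thesis
    by (rule borel_measurable_nn_integral)
qed

text \<open>
  A sum of at least \<open>1\<close> stays at least \<open>1\<close> if each summand is capped by a number that is itself at
  least \<open>1\<close>: either no cap is effective, or a single effective cap suffices.
\<close>

lemma one_le_sum_min:
  fixes a b :: "'a \<Rightarrow> ennreal"
  assumes "1 \<le> (\<integral>\<^sup>+z. a z \<partial>count_space UNIV)"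
    and "\<And>z. a z \<noteq> 0 \<Longrightarrow> 1 \<le> b z"
  shows "1 \<le> (\<integral>\<^sup>+z. min (b z) (a z) \<partial>count_space UNIV)"
proof (cases "\<exists>z. b z < a z")
  case True
  then obtain z where z: "b z < a z" by blast
  then have "1 \<le> b z" using assms(2)[of z] by (cases "a z = 0") auto
  also have "b z = (\<integral>\<^sup>+z'. min (b z') (a z') * indicator {z} z' \<partial>count_space UNIV)"
    using z by (simp add: min.absorb1 less_imp_le)
  also have "\<dots> \<le> (\<integral>\<^sup>+z. min (b z) (a z) \<partial>count_space UNIV)"
    by (intro nn_integral_mono) (simp split: split_indicator)
  finally show ?thesis .
next
  case False
  then have "min (b z) (a z) = a z" for z by (simp add: min_def not_less antisym)
  then show ?thesis using assms(1) by simp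
qed

text \<open>
  The series of the mean is the exponential series multiplied by \<open>l\<close> and shifted by one index.
\<close>

lemma poisson_pmf_mean:
  assumes "0 < l"
  shows "(\<integral>\<^sup>+n. of_nat n \<partial>measure_pmf (poisson_pmf l)) = ennreal l"
proof -
  have "(\<lambda>n. l ^ n / fact n) sums exp l"
    using exp_converges[of l] by (simp add: divide_inverse_commute)
  then have "(\<lambda>n. (l * exp (- l)) * (l ^ n / fact n)) sums ((l * exp (- l)) * exp l)"
    by (rule sums_mult)
  then have "(\<lambda>n. l ^ Suc n / fact (Suc n) * exp (- l) * real (Suc n)) sums l"
    by (simp add: exp_minus field_simps del: of_nat_Suc)
  then have "(\<lambda>n. l ^ n / fact n * exp (- l) * real n) sums l"
    by (subst (asm) sums_Suc_iff) simp
  then have "(\<lambda>n. ennreal (l ^ n / fact n * exp (- l) * real n)) sums ennreal l"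
    using assms by (intro sums_ennreal[THEN iffD2]) auto
  moreover have "(\<integral>\<^sup>+n. of_nat n \<partial>measure_pmf (poisson_pmf l))
      = (\<integral>\<^sup>+n. ennreal (l ^ n / fact n * exp (- l) * real n) \<partial>count_space UNIV)"
    using assms unfolding nn_integral_measure_pmf
    by (intro nn_integral_cong) (simp add: ennreal_of_nat_eq_real_of_nat flip: ennreal_mult)
  ultimately show ?thesis
    by (simp add: nn_integral_count_space_nat sums_iff)
qed

lemma ennreal_sum_le: "ennreal (\<Sum>i\<in>I. f i) \<le> (\<Sum>i\<in>I. ennreal (f i))"
proof (induction I rule: infinite_finite_induct)
  case (insert i I)
  have "ennreal (f i + sum f I) \<le> ennreal (max 0 (f i) + max 0 (sum f I))"
    by (intro ennreal_leI add_mono) auto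
  also have "\<dots> = ennreal (f i) + ennreal (sum f I)"
    by (simp add: ennreal_plus ennreal_max_0)
  also have "\<dots> \<le> ennreal (f i) + (\<Sum>i\<in>I. ennreal (f i))"
    using insert by (intro add_left_mono)
  finally show ?case using insert by simp
qed auto

text \<open>
  This is the probability that \<open>k + 1\<close> independent standard exponential times add up to at most
  \<open>a\<close>; it is the tail after index \<open>k\<close> of the exponential series at \<open>a\<close>, multiplied by \<open>exp (- a)\<close>.
\<close>

lemma erlang_CDF_tendsto_0:
  assumes "0 \<le> a"
  shows "(\<lambda>k. erlang_CDF k 1 a) \<longlonglongrightarrow> 0"
proof -
  have "(\<lambda>n. a ^ n / fact n) sums exp a"
    using exp_converges[of a] by (simp add: divide_inverse_commute)
  then have "(\<lambda>n. a ^ n / fact n * exp (- a)) sums (exp a * exp (- a))"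
    by (rule sums_mult2)
  then have "(\<lambda>n. a ^ n * exp (- a) / fact n) sums 1"
    by (simp add: exp_minus)
  then have "(\<lambda>k. 1 - (\<Sum>n\<le>k. a ^ n * exp (- a) / fact n)) \<longlonglongrightarrow> 1 - 1"
    unfolding sums_def_le by (intro tendsto_diff tendsto_const)
  then show ?thesis using assms by (simp add: erlang_CDF_def)
qed

text \<open>
  Dominated convergence: each summand vanishes with \<open>r\<close>, and \<open>b\<close> dominates them all.
\<close>

lemma nn_integral_min_tendsto_0:
  fixes a b :: "'a::countable \<Rightarrow> real"
  assumes b: "(\<integral>\<^sup>+x. ennreal (b x) \<partial>count_space UNIV) < \<infinity>"
  shows "((\<lambda>r. \<integral>\<^sup>+x. min (ennreal (a x * r)) (ennreal (b x)) \<partial>count_space UNIV) \<longlongrightarrow> 0) (at_right 0)"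
proof (rule tendsto_at_right_sequentially[of _ 1])
  fix S :: "nat \<Rightarrow> real" assume S: "S \<longlonglongrightarrow> 0"
  have "(\<lambda>n. \<integral>\<^sup>+x. min (ennreal (a x * S n)) (ennreal (b x)) \<partial>count_space UNIV)
      \<longlonglongrightarrow> (\<integral>\<^sup>+(x::'a). 0 \<partial>count_space UNIV)"
  proof (rule nn_integral_dominated_convergence[where w="\<lambda>x. ennreal (b x)"])
    show "AE x in count_space UNIV. (\<lambda>n. min (ennreal (a x * S n)) (ennreal (b x))) \<longlonglongrightarrow> 0"
    proof (rule AE_I2)
      fix x
      have "(\<lambda>n. ennreal (a x * S n)) \<longlonglongrightarrow> ennreal (a x * 0)"
        by (intro tendsto_ennrealI tendsto_intros S)
      then have "(\<lambda>n. min (ennreal (a x * S n)) (ennreal (b x))) \<longlonglongrightarrow> min (ennreal (a x * 0)) (ennreal (b x))"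
        by (intro tendsto_min tendsto_const)
      then show "(\<lambda>n. min (ennreal (a x * S n)) (ennreal (b x))) \<longlonglongrightarrow> 0" by (simp add: min_def)
    qed
  qed (use b in auto)
  then show "(\<lambda>n. \<integral>\<^sup>+x. min (ennreal (a x * S n)) (ennreal (b x)) \<partial>count_space UNIV) \<longlonglongrightarrow> 0"
    by simp
qed simp

section \<open>The range of an increasing pure-jump function with drift\<close>

text \<open>
  Continuity from below, which yields the left limit even where the measure is infinite.
\<close>

lemma emeasure_atMost_tendsto_at_left:
  fixes \<mu> :: "real measure"
  assumes sets: "sets \<mu> = sets borel"
  shows "((\<lambda>u. emeasure \<mu> {..u}) \<longlongrightarrow> emeasure \<mu> {..<s}) (at_left s)"
proof (rule order_tendstoI)
  fix a assume "a < emeasure \<mu> {..<s}"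
  have "(\<Union>n. {..s - 1 / Suc n}) = {..<s}"
  proof (intro equalityI subsetI)
    fix u assume "u \<in> {..<s}"
    then obtain n where "inverse (real (Suc n)) < s - u"
      using reals_Archimedean[of "s - u"] by auto
    then show "u \<in> (\<Union>n. {..s - 1 / Suc n})"
      by (intro UN_I[of n]) (auto simp: inverse_eq_divide)
  qed (auto simp: less_le_trans intro: le_less_trans)
  moreover have "(SUP n. emeasure \<mu> {..s - 1 / Suc n}) = emeasure \<mu> (\<Union>n. {..s - 1 / Suc n})"
    by (intro SUP_emeasure_incseq) (auto simp: sets incseq_def frac_le intro: order_trans)
  ultimately have "a < (SUP n. emeasure \<mu> {..s - 1 / Suc n})"
    using \<open>a < emeasure \<mu> {..<s}\<close> by simp
  then obtain n where n: "a < emeasure \<mu> {..s - 1 / Suc n}"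
    by (auto simp: less_SUP_iff)
  have "\<forall>\<^sub>F u in at_left s. s - 1 / Suc n < u"
    by (rule eventually_at_leftI[of "s - 1 / Suc n"]) auto
  then show "\<forall>\<^sub>F u in at_left s. a < emeasure \<mu> {..u}"
  proof eventually_elim
    case (elim u)
    have "emeasure \<mu> {..s - 1 / Suc n} \<le> emeasure \<mu> {..u}"
      using elim by (intro emeasure_mono) (auto simp: sets)
    with n show ?case by simp
  qed
next
  fix a assume a: "emeasure \<mu> {..<s} < a"
  have "\<forall>\<^sub>F u in at_left s. u < s"
    by (rule eventually_at_leftI[of "s - 1"]) auto
  then show "\<forall>\<^sub>F u in at_left s. emeasure \<mu> {..u} < a"
  proof eventually_elim
    case (elim u)
    have "emeasure \<mu> {..u} \<le> emeasure \<mu> {..<s}"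
      using elim by (intro emeasure_mono) (auto simp: sets)
    with a show ?case by simp
  qed
qed

text \<open>
  \<open>G\<close> is an increasing function with jumps of size \<open>\<mu> {s}\<close> at the points \<open>s\<close> of \<open>S\<close> and drift \<open>c\<close>,
  and \<open>L\<close> is its left limit. For \<open>s \<le> r\<close> the jump interval \<open>[L s, G s)\<close> lies below \<open>G r\<close>, and for
  \<open>s > r\<close> it lies above. By monotonicity of \<open>G\<close> the jump intervals are disjoint; those below \<open>G r\<close>
  have total length \<open>\<mu> {..r}\<close>, so the rest of \<open>[0, G r)\<close> has measure \<open>G r - \<mu> {..r} = c r\<close>.
\<close>

lemma emeasure_uncovered_by_jumps:
  fixes \<mu> :: "real measure" and c r :: real and S :: "real set"
  defines "G \<equiv> \<lambda>t. emeasure \<mu> {..t} + ennreal (c * t)"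
    and "L \<equiv> \<lambda>t. emeasure \<mu> {..<t} + ennreal (c * t)"
  assumes sets: "sets \<mu> = sets borel" and S: "countable S" "S \<subseteq> {0<..}"
    and atoms: "emeasure \<mu> (- S) = 0"
    and c: "0 \<le> c" and r: "0 \<le> r" and fin: "emeasure \<mu> {..r} < \<infinity>"
  shows "emeasure lborel {u. 0 \<le> u \<and> ennreal u < G r \<and> (\<forall>s\<in>S. \<not> (L s \<le> ennreal u \<and> ennreal u < G s))}
         = ennreal (c * r)"
proof -
  have borelS: "A \<in> sets \<mu>" if "A \<subseteq> S" for A
    using countable_subset[OF that S(1)] unfolding sets by (rule sets.countable[rotated]) auto
  have mono: "emeasure \<mu> A \<le> emeasure \<mu> B" if "A \<subseteq> B" "B \<in> sets borel" for A B
    using that sets by (intro emeasure_mono) auto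
  have fin': "emeasure \<mu> A < top" if "A \<subseteq> {..r}" for A
    using le_less_trans[OF mono[OF that] fin] by simp
  define g where "g t = enn2real (G t)" for t
  define l where "l t = enn2real (L t)" for t
  define S' where "S' = S \<inter> {..r}"
  have Gfin: "G t < top" if "t \<le> r" for t
    using fin'[of "{..t}"] that by (auto simp: G_def)
  have Lfin: "L t < top" if "t \<le> r" for t
    using fin'[of "{..<t}"] that by (force simp: L_def)
  have Gg: "G t = ennreal (g t)" if "t \<le> r" for t
    using Gfin[OF that] by (simp add: g_def)
  have Ll: "L t = ennreal (l t)" if "t \<le> r" for t
    using Lfin[OF that] by (simp add: l_def)
  have g0: "0 \<le> g t" and l0: "0 \<le> l t" for t by (simp_all add: g_def l_def)
  have LG: "L t \<le> G t" for t
    unfolding L_def G_def by (intro add_right_mono mono) auto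
  have GL: "G s \<le> L t" if "s < t" for s t
    unfolding L_def G_def using that c
    by (intro add_mono mono ennreal_leI mult_left_mono) auto
  have GG: "G s \<le> G t" if "s \<le> t" for s t
    using that GL[of s t] LG[of t] by (cases "s = t") auto
  define I where "I s = {l s..<g s}" for s
  have I: "L s \<le> ennreal u \<and> ennreal u < G s \<longleftrightarrow> u \<in> I s" if "s \<in> S'" "0 \<le> u" for s u
    using that Gg[of s] Ll[of s] g0[of s] l0[of s]
    by (auto simp: I_def S'_def ennreal_less_iff)
  have Isub: "I s \<subseteq> {0..<g r}" if "s \<in> S'" for s
  proof -
    have "s \<le> r" using that by (simp add: S'_def)
    then have "g s \<le> g r"
      using GG[of s r] Gg[of s] Gg[of r] g0 by (simp add: ennreal_le_iff)
    then show ?thesis using l0[of s] by (auto simp: I_def)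
  qed
  have leb_I: "emeasure lborel (I s) = emeasure \<mu> {s}" if "s \<in> S'" for s
  proof -
    have sr: "s \<le> r" using that by (simp add: S'_def)
    have lg: "l s \<le> g s" using LG[of s] Gg[OF sr] Ll[OF sr] g0 by (simp add: ennreal_le_iff)
    have "{..s} = {..<s} \<union> {s}" by auto
    then have "emeasure \<mu> {..s} = emeasure \<mu> {..<s} + emeasure \<mu> {s}"
      by (simp add: plus_emeasure sets)
    then have "G s = L s + emeasure \<mu> {s}" by (simp add: G_def L_def ac_simps)
    then have "emeasure \<mu> {s} = G s - L s"
      using Lfin[OF sr] by (simp add: ennreal_add_diff_cancel_left)
    also have "\<dots> = ennreal (g s - l s)"
      using Gg[OF sr] Ll[OF sr] l0 by (simp add: ennreal_minus)
    finally show ?thesis using lg by (simp add: I_def)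
  qed
  have cS': "countable S'" using S(1) by (auto simp: S'_def)
  have disj: "disjoint_family_on I S'"
  proof -
    have "I s \<inter> I t = {}" if "s \<in> S'" "t \<in> S'" "s < t" for s t
      
    proof -
      have "g s \<le> l t"
        using GL[OF that(3)] Gg[of s] Ll[of t] that l0[of t] by (simp add: S'_def ennreal_le_iff)
      then show ?thesis by (auto simp: I_def)
    qed
    then show ?thesis unfolding disjoint_family_on_def
      by (metis inf_commute linorder_neqE)
  qed
  \<comment> \<open>The union is indexed by jump times, so each interval is counted once and its length is one
    atom of \<open>\<mu>\<close>.\<close>
  have "emeasure lborel (\<Union>s\<in>S'. I s) = (\<integral>\<^sup>+s. emeasure lborel (I s) \<partial>count_space S')"
    by (intro emeasure_UN_countable cS' disj) (auto simp: I_def)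
  also have "\<dots> = (\<integral>\<^sup>+s. emeasure \<mu> {s} \<partial>count_space S')"
    by (intro nn_integral_cong leb_I) auto
  also have "\<dots> = emeasure \<mu> (\<Union>s\<in>S'. {s})"
    by (intro emeasure_UN_countable[symmetric] cS') (auto simp: sets disjoint_family_on_def)
  also have "\<dots> = emeasure \<mu> ((\<Union>s\<in>S'. {s}) \<union> ({..r} - S))"
  proof (rule emeasure_Un_null_set[symmetric])
    have "emeasure \<mu> ({..r} - S) \<le> emeasure \<mu> (- S)"
      using borelS[of S] sets by (intro emeasure_mono) (auto simp: Compl_eq_Diff_UNIV)
    then show "{..r} - S \<in> null_sets \<mu>"
      using atoms borelS[of S] sets by auto
  qed (use borelS[of S'] in \<open>auto simp: S'_def\<close>)
  also have "(\<Union>s\<in>S'. {s}) \<union> ({..r} - S) = {..r}" by (auto simp: S'_def)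
  finally have leb: "emeasure lborel (\<Union>s\<in>S'. I s) = emeasure \<mu> {..r}" .
  have meas: "(\<Union>s\<in>S'. I s) \<in> sets borel"
    using cS' by (auto simp: I_def)
  have "{u. 0 \<le> u \<and> ennreal u < G r \<and> (\<forall>s\<in>S. \<not> (L s \<le> ennreal u \<and> ennreal u < G s))}
        = {0..<g r} - (\<Union>s\<in>S'. I s)"
  proof -
    have "\<not> (L s \<le> ennreal u \<and> ennreal u < G s)" if "s \<in> S" "s \<notin> S'" "ennreal u < G r" for s u
      using GL[of r s] that by (auto simp: S'_def)
    moreover have "ennreal u < G r \<longleftrightarrow> u < g r" if "0 \<le> u" for u
      using that Gg[of r] g0 by (simp add: ennreal_less_iff)
    ultimately have "0 \<le> u \<and> ennreal u < G r \<and> (\<forall>s\<in>S. \<not> (L s \<le> ennreal u \<and> ennreal u < G s))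
        \<longleftrightarrow> 0 \<le> u \<and> u < g r \<and> (\<forall>s\<in>S'. u \<notin> I s)" for u
      using I[of _ u] unfolding S'_def by blast
    then show ?thesis by auto
  qed
  also have "emeasure lborel \<dots> = emeasure lborel {0..<g r} - emeasure lborel (\<Union>s\<in>S'. I s)"
    using Isub meas leb fin by (intro emeasure_Diff) auto
  also have "\<dots> = G r - emeasure \<mu> {..r}"
    using leb Gg[of r] g0 by simp
  also have "\<dots> = ennreal (c * r)"
    using fin by (simp add: G_def ennreal_add_diff_cancel_left)
  finally show ?thesis .
qed

section \<open>The clock as the distribution function of a random measure\<close>

context K_process_data
begin

definition marks :: "('s \<times> nat) set" where
  "marks = UNIV \<times> {1..}"

definition mark_time :: "'s \<times> nat \<Rightarrow> 'w \<Rightarrow> real" where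
  "mark_time j \<omega> = \<sigma> (fst j) (snd j) \<omega>"

definition jump_size :: "'s \<times> nat \<Rightarrow> 'w \<Rightarrow> ennreal" where
  "jump_size j \<omega> = ennreal (\<gamma> (fst j) * T (fst j) (snd j) \<omega>)"

definition state_jumps :: "'s \<Rightarrow> real \<Rightarrow> 'w \<Rightarrow> ennreal" where
  "state_jumps z t \<omega> = (\<Sum>n = 1..mark_count (\<sigma> z) t \<omega>. jump_size (z, n) \<omega>)"

text \<open>
  This measure on the time axis of the marks has mass \<open>\<gamma>\<^sub>z T\<^sup>z\<^sub>n\<close> at each mark \<open>\<sigma>\<^sup>z\<^sub>n\<close>. It turns
  the jump part of the clock into a distribution function and makes left limits of the clock an
  instance of continuity from below.
\<close>

definition jump_measure :: "'w \<Rightarrow> real measure" where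
  "jump_measure \<omega> =
     distr (density (count_space marks) (\<lambda>j. jump_size j \<omega>)) borel (\<lambda>j. mark_time j \<omega>)"

definition base_clock :: "real \<Rightarrow> 'w \<Rightarrow> ennreal" where
  "base_clock t \<omega> = emeasure (jump_measure \<omega>) {..t} + ennreal (c * t)"

definition base_clock_left :: "real \<Rightarrow> 'w \<Rightarrow> ennreal" where
  "base_clock_left t \<omega> = emeasure (jump_measure \<omega>) {..<t} + ennreal (c * t)"

text \<open>
  The set of times that the process started at \<open>\<infinity>\<close> spends at \<open>\<infinity>\<close>: the complement of the union of
  all jump intervals of its clock. The intervals are indexed by marks and not by times, but only
  their union enters, so that coinciding marks of different states do no harm.
\<close>

definition unvisited :: "'w \<Rightarrow> real set" where
  "unvisited \<omega> = {u. \<forall>j\<in>marks. \<not> (base_clock_left (mark_time j \<omega>) \<omega> \<le> ennreal u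
                                  \<and> ennreal u < base_clock (mark_time j \<omega>) \<omega>)}"

lemma countable_marks: "countable marks"
  by simp

lemma sets_jump_measure [simp]: "sets (jump_measure \<omega>) = sets borel"
  by (simp add: jump_measure_def)

lemma emeasure_jump_measure:
  assumes "B \<in> sets borel"
  shows "emeasure (jump_measure \<omega>) B
         = (\<integral>\<^sup>+j. jump_size j \<omega> * indicator B (mark_time j \<omega>) \<partial>count_space marks)"
proof -
  have "emeasure (jump_measure \<omega>) B
      = (\<integral>\<^sup>+j. jump_size j \<omega> * indicator {j \<in> marks. mark_time j \<omega> \<in> B} j \<partial>count_space marks)"
    unfolding jump_measure_def using assms
    by (subst emeasure_distr) (auto simp: emeasure_density vimage_def Int_def conj_commute)
  also have "\<dots> = (\<integral>\<^sup>+j. jump_size j \<omega> * indicator B (mark_time j \<omega>) \<partial>count_space marks)"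
    by (rule nn_integral_cong) (auto split: split_indicator)
  finally show ?thesis .
qed

lemma mark_less_Suc: "\<omega> \<in> space M \<Longrightarrow> 1 \<le> n \<Longrightarrow> \<sigma> x n \<omega> < \<sigma> x (Suc n) \<omega>"
  using poisson[of x] by (auto simp: poisson_process_with_marks_def)

lemma mark_mono:
  assumes "\<omega> \<in> space M" "1 \<le> m" "m \<le> n"
  shows "\<sigma> x m \<omega> \<le> \<sigma> x n \<omega>"
  using assms(3)
proof (induction rule: dec_induct)
  case (step n)
  then show ?case using mark_less_Suc[OF assms(1), of n x] assms(2) by simp
qed simp

lemma mark_pos:
  assumes "\<omega> \<in> space M" "1 \<le> n"
  shows "0 < \<sigma> x n \<omega>"
proof -
  have "0 < \<sigma> x 1 \<omega>"
    using poisson[of x] assms(1) by (auto simp: poisson_process_with_marks_def)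
  also have "\<dots> \<le> \<sigma> x n \<omega>" using assms by (intro mark_mono) auto
  finally show ?thesis .
qed

lemma marks_upto_eq:
  assumes "\<omega> \<in> space M"
  shows "{n. 1 \<le> n \<and> \<sigma> x n \<omega> \<le> t} = {1..mark_count (\<sigma> x) t \<omega>}"
  unfolding mark_count_def
proof (rule downward_closed_eq_atLeastAtMost_card)
  show "finite {n. 1 \<le> n \<and> \<sigma> x n \<omega> \<le> t}"
    using poisson[of x] assms by (auto simp: poisson_process_with_marks_def)
qed (auto intro: order_trans[OF mark_mono[OF assms]])

lemma mark_le_iff:
  assumes "\<omega> \<in> space M" "1 \<le> n"
  shows "\<sigma> x n \<omega> \<le> t \<longleftrightarrow> n \<le> mark_count (\<sigma> x) t \<omega>"
  using marks_upto_eq[OF assms(1), of x t] assms(2) by (auto simp: set_eq_iff)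

lemma mark_time_pos: "\<omega> \<in> space M \<Longrightarrow> j \<in> marks \<Longrightarrow> 0 < mark_time j \<omega>"
  by (auto simp: marks_def mark_time_def mark_pos)

lemma sum_upto_mark_count:
  fixes f :: "nat \<Rightarrow> ennreal"
  assumes "\<omega> \<in> space M"
  shows "(\<integral>\<^sup>+n. (if \<sigma> z n \<omega> \<le> t then f n else 0) \<partial>count_space {1..}) = (\<Sum>n = 1..mark_count (\<sigma> z) t \<omega>. f n)"
proof -
  have "(\<integral>\<^sup>+n. (if \<sigma> z n \<omega> \<le> t then f n else 0) \<partial>count_space {1..})
      = (\<Sum>n\<in>{1..mark_count (\<sigma> z) t \<omega>}. if \<sigma> z n \<omega> \<le> t then f n else 0)"
    using mark_le_iff[OF assms, of _ z t] by (intro nn_integral_count_space') auto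
  also have "\<dots> = (\<Sum>n = 1..mark_count (\<sigma> z) t \<omega>. f n)"
    using mark_le_iff[OF assms, of _ z t] by (intro sum.cong) auto
  finally show ?thesis .
qed

lemma jump_measure_atMost_eq:
  assumes "\<omega> \<in> space M"
  shows "emeasure (jump_measure \<omega>) {..t} = (\<integral>\<^sup>+z. state_jumps z t \<omega> \<partial>count_space UNIV)"
proof -
  let ?f = "\<lambda>j. jump_size j \<omega> * indicator {..t} (mark_time j \<omega>)"
  have "emeasure (jump_measure \<omega>) {..t} = (\<integral>\<^sup>+j. ?f j \<partial>count_space marks)"
    by (rule emeasure_jump_measure) simp
  also have "\<dots> = (\<integral>\<^sup>+j. ?f j * indicator marks j \<partial>count_space UNIV)"
    by (rule nn_integral_count_space_indicator) simp
  also have "\<dots> = (\<integral>\<^sup>+z. (\<integral>\<^sup>+n. ?f (z, n) * indicator marks (z, n) \<partial>count_space UNIV) \<partial>count_space UNIV)"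
    by (rule nn_integral_fst_count_space[symmetric])
  also have "\<dots> = (\<integral>\<^sup>+z. state_jumps z t \<omega> \<partial>count_space UNIV)"
  proof (intro nn_integral_cong)
    fix z :: 's
    have "(\<integral>\<^sup>+n. ?f (z, n) * indicator marks (z, n) \<partial>count_space UNIV)
        = (\<integral>\<^sup>+n. (if \<sigma> z n \<omega> \<le> t then jump_size (z, n) \<omega> else 0) * indicator {1..} n \<partial>count_space UNIV)"
      by (intro nn_integral_cong) (auto simp: mark_time_def marks_def split: split_indicator)
    also have "\<dots> = (\<integral>\<^sup>+n. (if \<sigma> z n \<omega> \<le> t then jump_size (z, n) \<omega> else 0) \<partial>count_space {1..})"
      by (rule nn_integral_count_space_indicator[symmetric]) simp
    also have "\<dots> = state_jumps z t \<omega>"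
      unfolding sum_upto_mark_count[OF assms] state_jumps_def ..
    finally show "(\<integral>\<^sup>+n. ?f (z, n) * indicator marks (z, n) \<partial>count_space UNIV) = \<dots>" .
  qed
  finally show ?thesis .
qed

lemma clock_eq:
  assumes "\<omega> \<in> space M"
  shows "clock \<gamma> c \<sigma> T0 T y t \<omega> = ennreal (gamma_ext \<gamma> y * T0 \<omega>) + base_clock t \<omega>"
  unfolding clock_def base_clock_def jump_measure_atMost_eq[OF assms]
    nn_integral_count_space_eq_infsum[OF infinite_states]
  by (simp add: state_jumps_def jump_size_def add.assoc)

lemma clock_left_eq:
  assumes "\<omega> \<in> space M"
  shows "clock_left \<gamma> c \<sigma> T0 T y s \<omega> = ennreal (gamma_ext \<gamma> y * T0 \<omega>) + base_clock_left s \<omega>"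
proof -
  have "((\<lambda>u. ennreal (c * u)) \<longlongrightarrow> ennreal (c * s)) (at_left s)"
    by (intro tendsto_ennrealI tendsto_intros)
  then have "((\<lambda>u. clock \<gamma> c \<sigma> T0 T y u \<omega>)
      \<longlongrightarrow> ennreal (gamma_ext \<gamma> y * T0 \<omega>) + base_clock_left s \<omega>) (at_left s)"
    unfolding clock_eq[OF assms] base_clock_def base_clock_left_def
    by (intro tendsto_add tendsto_const emeasure_atMost_tendsto_at_left) auto
  then show ?thesis
    unfolding clock_left_def by (intro tendsto_Lim) auto
qed

lemma K_process_eq_None_iff:
  assumes "\<omega> \<in> space M"
  shows "K_process \<gamma> c \<sigma> T0 T (Some x) t \<omega> = None \<longleftrightarrow>
    \<gamma> x * T0 \<omega> \<le> t \<and>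
    (\<forall>j\<in>marks. \<not> (ennreal (\<gamma> x * T0 \<omega>) + base_clock_left (mark_time j \<omega>) \<omega> \<le> ennreal t
              \<and> ennreal t < ennreal (\<gamma> x * T0 \<omega>) + base_clock (mark_time j \<omega>) \<omega>))"
proof -
  have "(\<exists>z. t \<in> visit_times \<gamma> c \<sigma> T0 T (Some x) z \<omega>) \<longleftrightarrow>
    (\<exists>j\<in>marks. ennreal (\<gamma> x * T0 \<omega>) + base_clock_left (mark_time j \<omega>) \<omega> \<le> ennreal t
            \<and> ennreal t < ennreal (\<gamma> x * T0 \<omega>) + base_clock (mark_time j \<omega>) \<omega>)"
    by (force simp: visit_times_def clock_eq[OF assms] clock_left_eq[OF assms] gamma_ext_def
          marks_def mark_time_def)
  then show ?thesis
    unfolding K_process_def by (simp add: gamma_ext_def not_less[of t "\<gamma> x * T0 \<omega>"])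
qed

text \<open>
  The clock of the process started at \<open>x\<close> is the clock started at \<open>\<infinity>\<close>, delayed by \<open>\<gamma>\<^sub>x T\<^sub>0\<close>.
\<close>

lemma K_process_eq_None_iff_unvisited:
  assumes "\<omega> \<in> space M" "0 \<le> T0 \<omega>"
  shows "K_process \<gamma> c \<sigma> T0 T (Some x) t \<omega> = None \<longleftrightarrow>
    \<gamma> x * T0 \<omega> \<le> t \<and> t - \<gamma> x * T0 \<omega> \<in> unvisited \<omega>"
proof (cases "\<gamma> x * T0 \<omega> \<le> t")
  case True
  have "0 \<le> \<gamma> x * T0 \<omega>" using assms(2) gamma_pos[of x] by simp
  then have t: "ennreal t = ennreal (\<gamma> x * T0 \<omega>) + ennreal (t - \<gamma> x * T0 \<omega>)"
    using True by (simp flip: ennreal_plus)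
  have le: "ennreal (\<gamma> x * T0 \<omega>) + a \<le> ennreal t \<longleftrightarrow> a \<le> ennreal (t - \<gamma> x * T0 \<omega>)" for a
    unfolding t ennreal_add_left_cancel_le by simp
  have less: "ennreal t < ennreal (\<gamma> x * T0 \<omega>) + a \<longleftrightarrow> ennreal (t - \<gamma> x * T0 \<omega>) < a" for a
    unfolding t ennreal_add_left_cancel_less by simp
  show ?thesis
    unfolding K_process_eq_None_iff[OF assms(1)] le less using True by (simp add: unvisited_def)
qed (simp add: K_process_eq_None_iff[OF assms(1)])

section \<open>Independence of the initial holding time from the clock\<close>

definition path_events :: "'w measure" where
  "path_events = vimage_algebra (space M) (\<lambda>\<omega>. \<lambda>x\<in>UNIV. mark_path (\<sigma> x) \<omega>)
     (Pi\<^sub>M UNIV (\<lambda>_. path_space))"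

definition holding_events :: "'w measure" where
  "holding_events = vimage_algebra (space M) (\<lambda>\<omega>. \<lambda>j\<in>Some ` marks. exp_family T0 T j \<omega>)
     (Pi\<^sub>M (Some ` marks) (\<lambda>_. borel))"

text \<open>
  The events that are determined by the marks and by all holding times other than \<open>T\<^sub>0\<close>. The clock
  started at \<open>\<infinity>\<close> is measurable with respect to these events.
\<close>

definition environment :: "'w measure" where
  "environment = sigma (space M) {A \<inter> B | A B. A \<in> sets path_events \<and> B \<in> sets holding_events}"

abbreviation all_holding_events :: "'w measure" where
  "all_holding_events \<equiv> vimage_algebra (space M) (\<lambda>\<omega>. \<lambda>j\<in>exp_index. exp_family T0 T j \<omega>)
     (Pi\<^sub>M exp_index (\<lambda>_. borel))"

lemma exp_index_eq: "exp_index = insert None (Some ` marks)"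
  by (simp add: exp_index_def marks_def)

lemma space_events [simp]:
  "space path_events = space M" "space holding_events = space M" "space environment = space M"
  by (simp_all add: path_events_def holding_events_def environment_def space_measure_of_conv)

text \<open>
  A mark is determined by the counting path: the \<open>n\<close>-th mark is at most \<open>a\<close> if and only if the
  path has reached \<open>n\<close> at time \<open>a\<close>.
\<close>

lemma mark_time_measurable_path_events:
  assumes "j \<in> marks"
  shows "mark_time j \<in> borel_measurable path_events"
proof (rule borel_measurableI_le)
  fix a :: real
  obtain x n where j: "j = (x, n)" "1 \<le> n" using assms by (auto simp: marks_def)
  show "{\<omega> \<in> space path_events. mark_time j \<omega> \<le> a} \<in> sets path_events"
  proof (cases "a < 0")
    case True
    then have "{\<omega> \<in> space path_events. mark_time j \<omega> \<le> a} = {}"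
      using mark_time_pos[OF _ assms] by force
    then show ?thesis by (metis sets.empty_sets)
  next
    case False
    have "(\<lambda>\<omega>. \<lambda>x\<in>UNIV. mark_path (\<sigma> x) \<omega>) \<in> measurable path_events (Pi\<^sub>M UNIV (\<lambda>_. path_space))"
      unfolding path_events_def
      by (rule measurable_vimage_algebra1) (auto simp: space_PiM mark_path_def)
    from measurable_compose[OF this measurable_component_singleton[of x]]
    have "mark_path (\<sigma> x) \<in> measurable path_events path_space" by simp
    from measurable_compose[OF this measurable_component_singleton[of a]] False
    have "(\<lambda>\<omega>. mark_path (\<sigma> x) \<omega> a) \<in> measurable path_events (count_space UNIV)" by simp
    from measurable_sets[OF this, of "{n..}"]
    have "{\<omega> \<in> space M. n \<le> mark_path (\<sigma> x) \<omega> a} \<in> sets path_events"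
      by (simp add: vimage_def Int_def conj_commute)
    also have "{\<omega> \<in> space M. n \<le> mark_path (\<sigma> x) \<omega> a} = {\<omega> \<in> space path_events. mark_time j \<omega> \<le> a}"
      using False j by (auto simp: mark_path_def mark_time_def mark_le_iff)
    finally show ?thesis .
  qed
qed

lemma exp_family_measurable_all:
  assumes "j \<in> exp_index"
  shows "exp_family T0 T j \<in> borel_measurable all_holding_events"
proof -
  have "(\<lambda>\<omega>. \<lambda>j\<in>exp_index. exp_family T0 T j \<omega>)
      \<in> measurable all_holding_events (Pi\<^sub>M exp_index (\<lambda>_. borel))"
    by (rule measurable_vimage_algebra1) (auto simp: space_PiM)
  from measurable_compose[OF this measurable_component_singleton[OF assms]] assms
  show ?thesis by simp
qed

lemma holding_measurable_holding_events:
  assumes "j \<in> marks"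
  shows "T (fst j) (snd j) \<in> borel_measurable holding_events"
proof -
  have "(\<lambda>\<omega>. \<lambda>j\<in>Some ` marks. exp_family T0 T j \<omega>)
      \<in> measurable holding_events (Pi\<^sub>M (Some ` marks) (\<lambda>_. borel))"
    unfolding holding_events_def
    by (rule measurable_vimage_algebra1) (auto simp: space_PiM)
  from measurable_compose[OF this measurable_component_singleton[of "Some j"]] assms
  show ?thesis by (simp add: exp_family_def split_beta)
qed

lemma sets_holding_events_subset: "sets holding_events \<subseteq> sets all_holding_events"
  unfolding holding_events_def
  by (intro sets_image_in_sets measurable_restrict exp_family_measurable_all)
     (auto simp: exp_index_eq)

lemma
  shows sets_path_events_subset: "sets path_events \<subseteq> sets M"
    and sets_all_holding_events_subset: "sets all_holding_events \<subseteq> sets M"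
    and prob_path_holding: "A \<in> sets path_events \<Longrightarrow> B \<in> sets all_holding_events \<Longrightarrow>
           prob (A \<inter> B) = prob A * prob B"
  using families_indep unfolding indep_sets2_eq path_events_def[symmetric] by auto

lemma sets_environment: "sets environment
    = sigma_sets (space M) {A \<inter> B | A B. A \<in> sets path_events \<and> B \<in> sets holding_events}"
  unfolding environment_def using sets.sets_into_space[of _ path_events]
  by (intro sets_measure_of) fastforce

lemma sets_environment_subset: "sets environment \<subseteq> sets M"
  using sets_path_events_subset sets_holding_events_subset sets_all_holding_events_subset
  unfolding sets_environment by (intro sets.sigma_sets_subset) auto

lemma path_events_in_environment: "sets path_events \<subseteq> sets environment"
proof
  fix A assume A: "A \<in> sets path_events"
  then have "A = A \<inter> space M" using sets.sets_into_space[OF A] by auto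
  moreover have "space M \<in> sets holding_events" using sets.top[of holding_events] by simp
  ultimately show "A \<in> sets environment"
    using A unfolding sets_environment by (intro sigma_sets.Basic) auto
qed

lemma holding_events_in_environment: "sets holding_events \<subseteq> sets environment"
proof
  fix A assume A: "A \<in> sets holding_events"
  then have "A = space M \<inter> A" using sets.sets_into_space[OF A] by auto
  moreover have "space M \<in> sets path_events" using sets.top[of path_events] by simp
  ultimately show "A \<in> sets environment"
    using A unfolding sets_environment by (intro sigma_sets.Basic) auto
qed

lemma measurable_environment_imp_measurable: "f \<in> measurable environment N \<Longrightarrow> f \<in> measurable M N"
  using measurable_mono[OF subset_refl refl sets_environment_subset] by auto

lemma mark_time_measurable: "j \<in> marks \<Longrightarrow> mark_time j \<in> borel_measurable environment"
  using measurable_mono[OF subset_refl refl path_events_in_environment]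
  by (rule subsetD) (simp_all add: mark_time_measurable_path_events)

lemma jump_size_measurable:
  assumes "j \<in> marks"
  shows "jump_size j \<in> borel_measurable environment"
proof -
  have "T (fst j) (snd j) \<in> borel_measurable environment"
    using measurable_mono[OF subset_refl refl holding_events_in_environment]
      holding_measurable_holding_events[OF assms] by auto
  then show ?thesis unfolding jump_size_def by measurable
qed

lemma T0_measurable: "T0 \<in> borel_measurable M"
  using exp_distributed[of None] distributed_measurable[of M lborel T0]
  by (simp add: exp_index_eq exp_family_def)

lemma prob_T0_holding:
  assumes C: "C \<in> sets borel" and B: "B \<in> sets holding_events"
  shows "prob ((T0 -` C \<inter> space M) \<inter> B) = prob (T0 -` C \<inter> space M) * prob B"
proof -
  let ?Y = "\<lambda>\<omega>. \<lambda>j\<in>Some ` marks. exp_family T0 T j \<omega>"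
  let ?X = "\<lambda>\<omega>. \<lambda>j\<in>{None}. exp_family T0 T j \<omega>"
  let ?C = "(\<lambda>f. f None) -` C \<inter> space (Pi\<^sub>M {None} (\<lambda>_. borel))"
  obtain B' where B': "B' \<in> sets (Pi\<^sub>M (Some ` marks) (\<lambda>_. borel))" "B = ?Y -` B' \<inter> space M"
    using B unfolding holding_events_def
    by (subst (asm) sets_vimage_algebra2) (auto simp: space_PiM)
  have "indep_var (Pi\<^sub>M {None} (\<lambda>_. borel)) ?X (Pi\<^sub>M (Some ` marks) (\<lambda>_. borel)) ?Y"
    by (rule indep_var_restrict[OF exp_indep]) (auto simp: exp_index_eq)
  moreover have "?C \<in> sets (Pi\<^sub>M {None} (\<lambda>_. borel))"
    using C by (intro measurable_sets[OF measurable_component_singleton]) auto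
  ultimately have "prob ((\<lambda>\<omega>. (?X \<omega>, ?Y \<omega>)) -` (?C \<times> B') \<inter> space M)
      = prob (?X -` ?C \<inter> space M) * prob (?Y -` B' \<inter> space M)"
    using B'(1) by (rule indep_varD)
  moreover have "?X -` ?C \<inter> space M = T0 -` C \<inter> space M"
    by (auto simp: exp_family_def space_PiM)
  moreover have "(\<lambda>\<omega>. (?X \<omega>, ?Y \<omega>)) -` (?C \<times> B') \<inter> space M = (T0 -` C \<inter> space M) \<inter> B"
    unfolding B'(2) by (auto simp: exp_family_def space_PiM)
  ultimately show ?thesis using B'(2) by simp
qed

text \<open>
  On the intersections of a mark event with a holding time event, the probability factorises in
  two steps: first the marks are separated from all holding times, then \<open>T\<^sub>0\<close> from the other ones.
  These intersections generate the environment and are stable under intersection.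
\<close>

lemma prob_T0_environment:
  assumes C: "C \<in> sets borel" and B: "B \<in> sets environment"
  shows "prob ((T0 -` C \<inter> space M) \<inter> B) = prob (T0 -` C \<inter> space M) * prob B"
proof -
  let ?E = "{A \<inter> B | A B. A \<in> sets path_events \<and> B \<in> sets holding_events}"
  let ?T = "{T0 -` C \<inter> space M | C. C \<in> sets borel}"
  have T0_all: "T0 -` C \<inter> space M \<in> sets all_holding_events" if "C \<in> sets borel" for C
    using measurable_sets[OF exp_family_measurable_all[of None] that]
    by (simp add: exp_index_eq exp_family_def)
  have "indep_set (sigma_sets (space M) ?T) (sigma_sets (space M) ?E)"
  proof (rule indep_set_sigma_sets)
    show "indep_set ?T ?E"
      unfolding indep_sets2_eq
    proof (intro conjI ballI)
      show "?T \<subseteq> events" using T0_measurable by (auto intro: measurable_sets)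
      show "?E \<subseteq> events"
        using sets_path_events_subset sets_holding_events_subset sets_all_holding_events_subset by auto
    next
      fix D F assume "D \<in> ?T" "F \<in> ?E"
      then obtain C A B where C: "C \<in> sets borel" "D = T0 -` C \<inter> space M"
        and A: "A \<in> sets path_events" and B: "B \<in> sets holding_events" and F: "F = A \<inter> B"
        by auto
      have D: "D \<in> sets all_holding_events" and B': "B \<in> sets all_holding_events"
        using T0_all C B sets_holding_events_subset by auto
      have "prob (D \<inter> F) = prob (A \<inter> (D \<inter> B))" unfolding F by (simp add: Int_left_commute)
      also have "\<dots> = prob A * prob (D \<inter> B)"
        using A D B' by (intro prob_path_holding) auto
      also have "prob (D \<inter> B) = prob D * prob B"
        using prob_T0_holding[OF C(1) B] C(2) by simp
      also have "prob A * (prob D * prob B) = prob D * prob (A \<inter> B)"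
        using A B' by (simp add: prob_path_holding)
      finally show "prob (D \<inter> F) = prob D * prob F" by (simp add: F)
    qed
    show "Int_stable ?T"
    proof (rule Int_stableI)
      fix a b assume "a \<in> ?T" "b \<in> ?T"
      then obtain C D where "C \<in> sets borel" "D \<in> sets borel" "a = T0 -` C \<inter> space M" "b = T0 -` D \<inter> space M"
        by auto
      then show "a \<inter> b \<in> ?T" by (auto intro!: exI[of _ "C \<inter> D"])
    qed
    show "Int_stable ?E"
    proof (rule Int_stableI)
      fix a b assume "a \<in> ?E" "b \<in> ?E"
      then obtain A B A' B' where "A \<in> sets path_events" "B \<in> sets holding_events" "a = A \<inter> B"
        "A' \<in> sets path_events" "B' \<in> sets holding_events" "b = A' \<inter> B'"
        by blast
      then have "A \<inter> A' \<in> sets path_events" "B \<inter> B' \<in> sets holding_events"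
         "a \<inter> b = (A \<inter> A') \<inter> (B \<inter> B')" by auto
      then show "a \<inter> b \<in> ?E" by blast
    qed
  qed
  then show ?thesis
    using B C unfolding sets_environment indep_sets2_eq by (blast intro: sigma_sets.Basic)
qed

section \<open>Measurability of the clock and of its uncovered times\<close>

text \<open>
  Evaluating the jump measure at random times is harmless because the jump measure is a countable
  sum of point masses, whose locations need only be compared with the given mark.
\<close>

lemma jump_measure_at_mark_measurable:
  assumes "j \<in> marks"
  shows "(\<lambda>\<omega>. emeasure (jump_measure \<omega>) {..<mark_time j \<omega>}) \<in> borel_measurable environment"
    and "(\<lambda>\<omega>. emeasure (jump_measure \<omega>) {..mark_time j \<omega>}) \<in> borel_measurable environment"
proof -
  note [measurable] = mark_time_measurable jump_size_measurable mark_time_measurable[OF assms]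
  have 1: "emeasure (jump_measure \<omega>) {..<mark_time j \<omega>} =
      (\<integral>\<^sup>+i. (if mark_time i \<omega> < mark_time j \<omega> then jump_size i \<omega> else 0) \<partial>count_space marks)" for \<omega>
    by (subst emeasure_jump_measure) (auto intro!: nn_integral_cong)
  have 2: "emeasure (jump_measure \<omega>) {..mark_time j \<omega>} =
      (\<integral>\<^sup>+i. (if mark_time i \<omega> \<le> mark_time j \<omega> then jump_size i \<omega> else 0) \<partial>count_space marks)" for \<omega>
    by (subst emeasure_jump_measure) (auto intro!: nn_integral_cong)
  show "(\<lambda>\<omega>. emeasure (jump_measure \<omega>) {..<mark_time j \<omega>}) \<in> borel_measurable environment"
    unfolding 1 by (rule borel_measurable_nn_integral_count_space[OF countable_marks]) measurable
  show "(\<lambda>\<omega>. emeasure (jump_measure \<omega>) {..mark_time j \<omega>}) \<in> borel_measurable environment"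
    unfolding 2 by (rule borel_measurable_nn_integral_count_space[OF countable_marks]) measurable
qed

lemma base_clock_measurable:
  assumes "j \<in> marks"
  shows "(\<lambda>\<omega>. base_clock_left (mark_time j \<omega>) \<omega>) \<in> borel_measurable environment"
    and "(\<lambda>\<omega>. base_clock (mark_time j \<omega>) \<omega>) \<in> borel_measurable environment"
proof -
  note [measurable] = mark_time_measurable[OF assms] jump_measure_at_mark_measurable[OF assms]
  show "(\<lambda>\<omega>. base_clock_left (mark_time j \<omega>) \<omega>) \<in> borel_measurable environment"
    and "(\<lambda>\<omega>. base_clock (mark_time j \<omega>) \<omega>) \<in> borel_measurable environment"
    unfolding base_clock_left_def base_clock_def by measurable
qed

lemma jump_measure_upto_measurable:
  "(\<lambda>\<omega>. emeasure (jump_measure \<omega>) {..r}) \<in> borel_measurable environment"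
proof -
  note [measurable] = mark_time_measurable jump_size_measurable
  have "emeasure (jump_measure \<omega>) {..r} =
      (\<integral>\<^sup>+i. (if mark_time i \<omega> \<le> r then jump_size i \<omega> else 0) \<partial>count_space marks)" for \<omega>
    by (subst emeasure_jump_measure) (auto intro!: nn_integral_cong)
  then show ?thesis
    by (simp add: borel_measurable_nn_integral_count_space[OF countable_marks])
qed

lemma unvisited_measurable [measurable]:
  "Measurable.pred (borel \<Otimes>\<^sub>M environment) (\<lambda>z. fst z \<in> unvisited (snd z))"
proof -
  note [measurable] = measurable_compose[OF measurable_snd base_clock_measurable(1)]
    measurable_compose[OF measurable_snd base_clock_measurable(2)]
  have "Measurable.pred (borel \<Otimes>\<^sub>M environment)
     (\<lambda>z. \<forall>j\<in>marks. \<not> (base_clock_left (mark_time j (snd z)) (snd z) \<le> ennreal (fst z)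
         \<and> ennreal (fst z) < base_clock (mark_time j (snd z)) (snd z)))"
    by (intro pred_intros_countable_bounded countable_marks) measurable
  then show ?thesis by (simp add: unvisited_def)
qed

lemma indicator_unvisited_measurable:
  "indicator {z. fst z \<in> {0..t} \<and> fst z \<in> unvisited (snd z)}
     \<in> (borel_measurable (borel \<Otimes>\<^sub>M environment) :: (real \<times> 'w \<Rightarrow> ennreal) set)"
proof -
  have "Measurable.pred (borel \<Otimes>\<^sub>M environment) (\<lambda>z. fst z \<in> {0..t} \<and> fst z \<in> unvisited (snd z))"
    by measurable
  then show ?thesis
    by (simp add: borel_measurable_indicator_iff pred_def Int_def conj_commute)
qed

text \<open>
  The event has to be measurable and not only almost surely equal to a measurable event. Hence it
  is described in a way that is also valid for negative values of \<open>T\<^sub>0\<close>.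
\<close>

lemma None_event_measurable:
  "{\<omega> \<in> space M. K_process \<gamma> c \<sigma> T0 T (Some x) t \<omega> = None} \<in> events"
proof -
  note [measurable] = T0_measurable
    base_clock_measurable[THEN measurable_environment_imp_measurable]
  have "Measurable.pred M (\<lambda>\<omega>. \<gamma> x * T0 \<omega> \<le> t \<and>
    (\<forall>j\<in>marks. \<not> (ennreal (\<gamma> x * T0 \<omega>) + base_clock_left (mark_time j \<omega>) \<omega> \<le> ennreal t
              \<and> ennreal t < ennreal (\<gamma> x * T0 \<omega>) + base_clock (mark_time j \<omega>) \<omega>)))"
    by (intro pred_intros_logic pred_intros_countable_bounded countable_marks) measurable
  then have "{\<omega> \<in> space M. \<gamma> x * T0 \<omega> \<le> t \<and>
    (\<forall>j\<in>marks. \<not> (ennreal (\<gamma> x * T0 \<omega>) + base_clock_left (mark_time j \<omega>) \<omega> \<le> ennreal t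
              \<and> ennreal t < ennreal (\<gamma> x * T0 \<omega>) + base_clock (mark_time j \<omega>) \<omega>))} \<in> events"
    by (simp add: pred_def)
  also have "{\<omega> \<in> space M. \<gamma> x * T0 \<omega> \<le> t \<and>
    (\<forall>j\<in>marks. \<not> (ennreal (\<gamma> x * T0 \<omega>) + base_clock_left (mark_time j \<omega>) \<omega> \<le> ennreal t
              \<and> ennreal t < ennreal (\<gamma> x * T0 \<omega>) + base_clock (mark_time j \<omega>) \<omega>))}
      = {\<omega> \<in> space M. K_process \<gamma> c \<sigma> T0 T (Some x) t \<omega> = None}"
    using K_process_eq_None_iff by blast
  finally show ?thesis .
qed

section \<open>Reduction to the expected time left uncovered by the clock\<close>

definition unvisited_time :: "real \<Rightarrow> 'w \<Rightarrow> ennreal" where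
  "unvisited_time t \<omega> = emeasure lborel ({0..t} \<inter> unvisited \<omega>)"

lemma unvisited_section_borel:
  assumes "\<omega> \<in> space M"
  shows "unvisited \<omega> \<in> sets borel"
proof -
  have "Measurable.pred borel (\<lambda>u. (fst (u, \<omega>)) \<in> unvisited (snd (u, \<omega>)))"
    using assms by (intro measurable_compose[OF _ unvisited_measurable] measurable_Pair2') simp
  then show ?thesis by (simp add: pred_def)
qed

lemma unvisited_time_eq_nn_integral:
  assumes "\<omega> \<in> space M"
  shows "unvisited_time t \<omega> = (\<integral>\<^sup>+u. indicator {u. u \<in> {0..t} \<and> u \<in> unvisited \<omega>} u \<partial>lborel)"
  unfolding unvisited_time_def using unvisited_section_borel[OF assms]
  by (subst nn_integral_indicator) (auto simp: Int_def intro!: sets.Int[unfolded Int_def])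

lemma unvisited_time_measurable: "unvisited_time t \<in> borel_measurable environment"
proof -
  have "(\<lambda>\<omega>. \<integral>\<^sup>+u. indicator {u. u \<in> {0..t} \<and> u \<in> unvisited \<omega>} u \<partial>lborel)
      \<in> borel_measurable environment"
  proof (rule lborel.borel_measurable_nn_integral)
    have "(\<lambda>z. (snd z, fst z)) \<in> measurable (environment \<Otimes>\<^sub>M lborel) (borel \<Otimes>\<^sub>M environment)"
      by measurable
    from measurable_compose[OF this indicator_unvisited_measurable[of t]]
    show "(\<lambda>(\<omega>, u). indicator {u. u \<in> {0..t} \<and> u \<in> unvisited \<omega>} u :: ennreal)
        \<in> borel_measurable (environment \<Otimes>\<^sub>M lborel)"
      by (simp add: split_beta' indicator_def)
  qed
  then show ?thesis
    by (subst measurable_cong[OF unvisited_time_eq_nn_integral]) simp_all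
qed

text \<open>
  The substitution \<open>s = t - \<gamma>\<^sub>x u\<close>, which runs through \<open>[0, t]\<close> when the initial holding time \<open>u\<close>
  runs through \<open>[0, t / \<gamma>\<^sub>x]\<close>.
\<close>

lemma unvisited_time_scaled:
  assumes "\<omega> \<in> space M"
  shows "(\<integral>\<^sup>+u. indicator ({0..t} \<inter> unvisited \<omega>) (t - \<gamma> x * u) \<partial>lborel)
         = ennreal (1 / \<gamma> x) * unvisited_time t \<omega>"
proof -
  have "unvisited_time t \<omega> = (\<integral>\<^sup>+u. indicator ({0..t} \<inter> unvisited \<omega>) u \<partial>lborel)"
    unfolding unvisited_time_def using unvisited_section_borel[OF assms] by simp
  also have "\<dots> = ennreal \<bar>- \<gamma> x\<bar> * (\<integral>\<^sup>+u. indicator ({0..t} \<inter> unvisited \<omega>) (t + (- \<gamma> x) * u) \<partial>lborel)"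
    using unvisited_section_borel[OF assms] gamma_pos[of x]
    by (intro nn_integral_real_affine) auto
  finally have "ennreal (1 / \<gamma> x) * unvisited_time t \<omega>
      = (ennreal (1 / \<gamma> x) * ennreal (\<gamma> x)) * (\<integral>\<^sup>+u. indicator ({0..t} \<inter> unvisited \<omega>) (t - \<gamma> x * u) \<partial>lborel)"
    using gamma_pos[of x] by (simp add: mult.assoc)
  then show ?thesis
    using gamma_pos[of x] by (simp flip: ennreal_mult)
qed

lemma T0_distributed: "distributed M lborel T0 (exponential_density 1)"
  using exp_distributed[of None] by (simp add: exp_index_eq exp_family_def)

lemma T0_pos_AE: "AE \<omega> in M. 0 < T0 \<omega>"
proof -
  have "prob {\<omega> \<in> space M. T0 \<omega> \<le> 0} = 0"
    using exponential_distributedD_le[OF T0_distributed, of 0] by simp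
  moreover have "{\<omega> \<in> space M. T0 \<omega> \<le> 0} \<in> events"
    using T0_measurable by measurable
  ultimately have "AE \<omega> in M. \<not> T0 \<omega> \<le> 0"
    by (simp add: prob_eq_0)
  then show ?thesis by eventually_elim simp
qed

text \<open>
  Conditionally on the environment, \<open>T\<^sub>0\<close> is still exponential, and the event says that the time
  \<open>t - \<gamma>\<^sub>x T\<^sub>0\<close> which is left after the initial holding time is an uncovered one.
\<close>

lemma emeasure_None_event:
  "emeasure M {\<omega> \<in> space M. K_process \<gamma> c \<sigma> T0 T (Some x) t \<omega> = None} =
    (\<integral>\<^sup>+\<omega>. (\<integral>\<^sup>+u. ennreal (exponential_density 1 u)
        * indicator ({0..t} \<inter> unvisited \<omega>) (t - \<gamma> x * u) \<partial>lborel) \<partial>M)"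
proof -
  let ?F = "\<lambda>u \<omega>. indicator {z. fst z \<in> {0..t} \<and> fst z \<in> unvisited (snd z)} (t - \<gamma> x * u, \<omega>) :: ennreal"
  have F: "case_prod ?F \<in> borel_measurable (borel \<Otimes>\<^sub>M environment)"
  proof -
    have "(\<lambda>z. (t - \<gamma> x * fst z, snd z)) \<in> measurable (borel \<Otimes>\<^sub>M environment) (borel \<Otimes>\<^sub>M environment)"
      by measurable
    moreover have "indicator {z. fst z \<in> {0..t} \<and> fst z \<in> unvisited (snd z)}
        \<in> (borel_measurable (borel \<Otimes>\<^sub>M environment) :: (real \<times> 'w \<Rightarrow> ennreal) set)"
      by (rule indicator_unvisited_measurable)
    ultimately have "(\<lambda>z. ?F (fst z) (snd z)) \<in> borel_measurable (borel \<Otimes>\<^sub>M environment)"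
      by (rule measurable_compose)
    then show ?thesis by (simp add: split_beta')
  qed
  have F_eq: "?F u \<omega> = indicator ({0..t} \<inter> unvisited \<omega>) (t - \<gamma> x * u)" for u \<omega>
    by (auto split: split_indicator)
  have distr: "distr M borel T0 = density lborel (exponential_density 1)"
    using distributed_distr_eq_density[OF T0_distributed]
    by (metis distr_cong sets_lborel)
  have "emeasure M {\<omega> \<in> space M. K_process \<gamma> c \<sigma> T0 T (Some x) t \<omega> = None}
      = (\<integral>\<^sup>+\<omega>. indicator {\<omega> \<in> space M. K_process \<gamma> c \<sigma> T0 T (Some x) t \<omega> = None} \<omega> \<partial>M)"
    using None_event_measurable by simp
  also have "\<dots> = (\<integral>\<^sup>+\<omega>. ?F (T0 \<omega>) \<omega> \<partial>M)"
  proof (rule nn_integral_cong_AE)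
    \<comment> \<open>Negative values of \<open>T\<^sub>0\<close>, for which the two events may differ, form a null set.\<close>
    show "AE \<omega> in M. indicator {\<omega> \<in> space M. K_process \<gamma> c \<sigma> T0 T (Some x) t \<omega> = None} \<omega> = ?F (T0 \<omega>) \<omega>"
      using T0_pos_AE AE_space
    proof eventually_elim
      case (elim \<omega>)
      have "0 < \<gamma> x * T0 \<omega>" using elim gamma_pos by simp
      then show ?case
        using elim K_process_eq_None_iff_unvisited[of \<omega> x t] by (auto split: split_indicator)
    qed
  qed
  also have "\<dots> = (\<integral>\<^sup>+\<omega>. (\<integral>\<^sup>+u. ?F u \<omega> \<partial>distr M borel T0) \<partial>M)"
  proof (rule nn_integral_independent[OF T0_measurable _ _ F])
    show "(\<lambda>\<omega>. \<omega>) \<in> measurable M environment"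
      by (intro measurable_environment_imp_measurable) simp
    fix C :: "real set" and B assume "C \<in> sets borel" "B \<in> sets environment"
    moreover from this(2) have "(\<lambda>\<omega>. \<omega>) -` B \<inter> space M = B"
      using sets.sets_into_space[of B environment] by auto
    ultimately show "prob ((T0 -` C \<inter> space M) \<inter> ((\<lambda>\<omega>. \<omega>) -` B \<inter> space M))
        = prob (T0 -` C \<inter> space M) * prob ((\<lambda>\<omega>. \<omega>) -` B \<inter> space M)"
      using prob_T0_environment by simp
  qed
  also have "\<dots> = (\<integral>\<^sup>+\<omega>. (\<integral>\<^sup>+u. ennreal (exponential_density 1 u) * ?F u \<omega> \<partial>lborel) \<partial>M)"
    unfolding distr
  proof (intro nn_integral_cong nn_integral_density)
    fix \<omega> assume "\<omega> \<in> space M"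
    then have "(\<lambda>u. case_prod ?F (u, \<omega>)) \<in> borel_measurable borel"
      by (intro measurable_compose[OF _ F] measurable_Pair2') simp
    then show "(\<lambda>u. ?F u \<omega>) \<in> borel_measurable lborel" by simp
  qed auto
  finally show ?thesis unfolding F_eq .
qed

text \<open>
  For an initial holding time \<open>u\<close> in \<open>[0, t / \<gamma>\<^sub>x]\<close> the exponential density lies between \<open>exp (- t
  / \<gamma>\<^sub>x)\<close> and \<open>1\<close>.
\<close>

lemma None_probability_bounds:
  shows "emeasure M {\<omega> \<in> space M. K_process \<gamma> c \<sigma> T0 T (Some x) t \<omega> = None}
           \<le> ennreal (1 / \<gamma> x) * (\<integral>\<^sup>+\<omega>. unvisited_time t \<omega> \<partial>M)"
    and "ennreal (exp (- t / \<gamma> x) / \<gamma> x) * (\<integral>\<^sup>+\<omega>. unvisited_time t \<omega> \<partial>M)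
           \<le> emeasure M {\<omega> \<in> space M. K_process \<gamma> c \<sigma> T0 T (Some x) t \<omega> = None}"
proof -
  let ?I = "\<lambda>\<omega> u. indicator ({0..t} \<inter> unvisited \<omega>) (t - \<gamma> x * u) :: ennreal"
  note meas [measurable] = unvisited_time_measurable[THEN measurable_environment_imp_measurable]
  have bounds: "0 \<le> u \<and> u \<le> t / \<gamma> x" if "t - \<gamma> x * u \<in> {0..t}" for u
    using that gamma_pos[of x] by (auto simp: field_simps zero_le_mult_iff)
  have I_meas: "?I \<omega> \<in> borel_measurable borel" if "\<omega> \<in> space M" for \<omega>
    using unvisited_section_borel[OF that] by measurable
  have "emeasure M {\<omega> \<in> space M. K_process \<gamma> c \<sigma> T0 T (Some x) t \<omega> = None}
      \<le> (\<integral>\<^sup>+\<omega>. (\<integral>\<^sup>+u. ?I \<omega> u \<partial>lborel) \<partial>M)"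
    unfolding emeasure_None_event
  proof (intro nn_integral_mono)
    fix \<omega> u
    show "ennreal (exponential_density 1 u) * ?I \<omega> u \<le> ?I \<omega> u"
      using bounds[of u] by (auto simp: exponential_density_def split: split_indicator)
  qed
  also have "\<dots> = (\<integral>\<^sup>+\<omega>. ennreal (1 / \<gamma> x) * unvisited_time t \<omega> \<partial>M)"
    by (intro nn_integral_cong unvisited_time_scaled)
  also have "\<dots> = ennreal (1 / \<gamma> x) * (\<integral>\<^sup>+\<omega>. unvisited_time t \<omega> \<partial>M)"
    by (intro nn_integral_cmult meas)
  finally show "emeasure M {\<omega> \<in> space M. K_process \<gamma> c \<sigma> T0 T (Some x) t \<omega> = None}
           \<le> ennreal (1 / \<gamma> x) * (\<integral>\<^sup>+\<omega>. unvisited_time t \<omega> \<partial>M)" .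
  have "ennreal (exp (- t / \<gamma> x) / \<gamma> x) * (\<integral>\<^sup>+\<omega>. unvisited_time t \<omega> \<partial>M)
      = (\<integral>\<^sup>+\<omega>. ennreal (exp (- t / \<gamma> x)) * (ennreal (1 / \<gamma> x) * unvisited_time t \<omega>) \<partial>M)"
    using gamma_pos[of x]
    by (subst nn_integral_cmult[symmetric])
       (auto simp: meas mult.assoc[symmetric] simp flip: ennreal_mult)
  also have "\<dots> = (\<integral>\<^sup>+\<omega>. (\<integral>\<^sup>+u. ennreal (exp (- t / \<gamma> x)) * ?I \<omega> u \<partial>lborel) \<partial>M)"
    using I_meas by (intro nn_integral_cong) (simp add: nn_integral_cmult unvisited_time_scaled)
  also have "\<dots> \<le> emeasure M {\<omega> \<in> space M. K_process \<gamma> c \<sigma> T0 T (Some x) t \<omega> = None}"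
    unfolding emeasure_None_event
  proof (intro nn_integral_mono)
    fix \<omega> u
    show "ennreal (exp (- t / \<gamma> x)) * ?I \<omega> u \<le> ennreal (exponential_density 1 u) * ?I \<omega> u"
      using bounds[of u] by (auto simp: exponential_density_def intro!: ennreal_leI split: split_indicator)
  qed
  finally show "ennreal (exp (- t / \<gamma> x) / \<gamma> x) * (\<integral>\<^sup>+\<omega>. unvisited_time t \<omega> \<partial>M)
           \<le> emeasure M {\<omega> \<in> space M. K_process \<gamma> c \<sigma> T0 T (Some x) t \<omega> = None}" .
qed

section \<open>Uncovered time on a single path\<close>

lemma emeasure_unvisited_below_base_clock:
  assumes \<omega>: "\<omega> \<in> space M" and r: "0 \<le> r" and fin: "emeasure (jump_measure \<omega>) {..r} < \<infinity>"
  shows "emeasure lborel {u. 0 \<le> u \<and> ennreal u < base_clock r \<omega> \<and> u \<in> unvisited \<omega>} = ennreal (c * r)"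
proof -
  let ?S = "(\<lambda>j. mark_time j \<omega>) ` marks"
  have S: "countable ?S" by (intro countable_image countable_marks)
  have "emeasure (jump_measure \<omega>) (- ?S)
      = (\<integral>\<^sup>+j. jump_size j \<omega> * indicator (- ?S) (mark_time j \<omega>) \<partial>count_space marks)"
    by (rule emeasure_jump_measure, rule borel_comp, rule sets.countable[OF _ S]) simp
  also have "\<dots> = (\<integral>\<^sup>+j. 0 \<partial>count_space marks)"
    by (intro nn_integral_cong) (auto split: split_indicator)
  finally have "emeasure (jump_measure \<omega>) (- ?S) = 0" by simp
  moreover have "?S \<subseteq> {0<..}"
    using mark_time_pos[OF \<omega>] by auto
  ultimately show ?thesis
    using emeasure_uncovered_by_jumps[OF sets_jump_measure S _ _ c_nonneg r fin]
    by (simp add: base_clock_def base_clock_left_def unvisited_def)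
qed

lemma unvisited_time_ge:
  assumes \<omega>: "\<omega> \<in> space M" and r: "0 \<le> r" and t: "base_clock r \<omega> \<le> ennreal t"
  shows "ennreal (c * r) \<le> unvisited_time t \<omega>"
proof -
  have "emeasure (jump_measure \<omega>) {..r} \<le> base_clock r \<omega>" by (simp add: base_clock_def)
  also note t
  finally have fin: "emeasure (jump_measure \<omega>) {..r} < \<infinity>" by (rule le_less_trans) simp
  have "{u. 0 \<le> u \<and> ennreal u < base_clock r \<omega> \<and> u \<in> unvisited \<omega>} \<subseteq> {0..t} \<inter> unvisited \<omega>"
  proof safe
    fix u assume "0 \<le> u" "ennreal u < base_clock r \<omega>"
    with t have "ennreal u < ennreal t" by (meson less_le_trans)
    with \<open>0 \<le> u\<close> show "u \<in> {0..t}" by (simp add: ennreal_less_iff)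
  qed
  then show ?thesis
    unfolding emeasure_unvisited_below_base_clock[OF \<omega> r fin, symmetric] unvisited_time_def
    using unvisited_section_borel[OF \<omega>] by (intro emeasure_mono) auto
qed

lemma unvisited_time_eq_0:
  assumes \<omega>: "\<omega> \<in> space M" and r: "0 \<le> r" and fin: "emeasure (jump_measure \<omega>) {..r} < \<infinity>"
    and t: "ennreal t < base_clock r \<omega>" and "c = 0"
  shows "unvisited_time t \<omega> = 0"
proof -
  let ?U = "{u. 0 \<le> u \<and> ennreal u < base_clock r \<omega> \<and> u \<in> unvisited \<omega>}"
  have "?U = {0..} \<inter> {u. ennreal u < base_clock r \<omega>} \<inter> unvisited \<omega>" by auto
  also have "\<dots> \<in> sets borel"
    using unvisited_section_borel[OF \<omega>] by (intro sets.Int) auto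
  finally have U: "?U \<in> sets borel" .
  have "{0..t} \<inter> unvisited \<omega> \<subseteq> ?U"
    using t by (auto intro: le_less_trans[OF ennreal_leI])
  then have "unvisited_time t \<omega> \<le> emeasure lborel ?U"
    unfolding unvisited_time_def using U by (intro emeasure_mono) auto
  also have "\<dots> = 0"
    unfolding emeasure_unvisited_below_base_clock[OF \<omega> r fin] using \<open>c = 0\<close> by simp
  finally show ?thesis by simp
qed

section \<open>Expected jumps of the clock\<close>

lemma mark_count_0: "\<omega> \<in> space M \<Longrightarrow> mark_count (\<sigma> z) 0 \<omega> = 0"
  using mark_le_iff[of \<omega> 1 z 0] mark_pos[of \<omega> 1 z] by simp

lemma mark_count_measurable: "0 \<le> r \<Longrightarrow> mark_count (\<sigma> z) r \<in> measurable M (count_space UNIV)"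
  using poisson[of z] by (auto simp: poisson_process_with_marks_def)

lemma expected_mark_count:
  assumes "0 < r"
  shows "(\<integral>\<^sup>+\<omega>. of_nat (mark_count (\<sigma> z) r \<omega>) \<partial>M) = ennreal (rate z * r)"
proof -
  note [measurable] = mark_count_measurable
  have "\<forall>s t. 0 \<le> s \<and> s < t \<longrightarrow>
        distr M (count_space UNIV) (\<lambda>\<omega>. mark_count (\<sigma> z) t \<omega> - mark_count (\<sigma> z) s \<omega>)
          = measure_pmf (poisson_pmf (rate z * (t - s)))"
    using poisson[of z] unfolding poisson_process_with_marks_def by blast
  from this[rule_format, of 0 r]
  have distr: "distr M (count_space UNIV) (\<lambda>\<omega>. mark_count (\<sigma> z) r \<omega> - mark_count (\<sigma> z) 0 \<omega>)
      = measure_pmf (poisson_pmf (rate z * r))"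
    using assms by simp
  have "(\<integral>\<^sup>+\<omega>. of_nat (mark_count (\<sigma> z) r \<omega>) \<partial>M)
      = (\<integral>\<^sup>+\<omega>. of_nat (mark_count (\<sigma> z) r \<omega> - mark_count (\<sigma> z) 0 \<omega>) \<partial>M)"
    by (intro nn_integral_cong) (simp add: mark_count_0)
  also have "\<dots> = (\<integral>\<^sup>+n. of_nat n \<partial>measure_pmf (poisson_pmf (rate z * r)))"
    unfolding distr[symmetric] using mark_count_measurable[of r z] mark_count_measurable[of 0 z] assms
    by (subst nn_integral_distr) auto
  also have "\<dots> = ennreal (rate z * r)"
    using rate_pos[of z] assms by (intro poisson_pmf_mean) simp
  finally show ?thesis .
qed

lemma expected_jump_size:
  assumes "(z, n) \<in> marks"
  shows "(\<integral>\<^sup>+\<omega>. jump_size (z, n) \<omega> \<partial>M) = ennreal (\<gamma> z)"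
proof -
  have D: "distributed M lborel (T z n) (exponential_density 1)"
    using exp_distributed[of "Some (z, n)"] assms by (simp add: exp_index_eq exp_family_def)
  have "(\<integral>\<^sup>+\<omega>. jump_size (z, n) \<omega> \<partial>M) = (\<integral>\<^sup>+\<omega>. ennreal (\<gamma> z * T z n \<omega>) \<partial>M)"
    by (simp add: jump_size_def)
  also have "\<dots> = (\<integral>\<^sup>+u. ennreal (exponential_density 1 u) * ennreal (\<gamma> z * u) \<partial>lborel)"
    by (rule distributed_nn_integral[OF D, symmetric]) simp
  also have "\<dots> = (\<integral>\<^sup>+u. ennreal (\<gamma> z) * ennreal (erlang_density 0 1 u * u ^ 1) \<partial>lborel)"
    using gamma_pos[of z]
    by (intro nn_integral_cong)
       (auto simp: erlang_density_def ennreal_mult'[symmetric] mult_ac)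
  also have "\<dots> = ennreal (\<gamma> z) * (\<integral>\<^sup>+u. ennreal (erlang_density 0 1 u * u ^ 1) \<partial>lborel)"
    by (rule nn_integral_cmult) simp
  also have "\<dots> = ennreal (\<gamma> z)"
    by (subst nn_integral_erlang_ith_moment) simp_all
  finally show ?thesis .
qed

lemma state_jumps_eq:
  "\<omega> \<in> space M \<Longrightarrow> state_jumps z r \<omega>
     = (\<integral>\<^sup>+n. (if \<sigma> z n \<omega> \<le> r then jump_size (z, n) \<omega> else 0) \<partial>count_space {1..})"
  unfolding state_jumps_def by (rule sum_upto_mark_count[symmetric])

lemma marks_iff: "(z, n) \<in> marks \<longleftrightarrow> 1 \<le> n"
  by (simp add: marks_def)

lemma mark_jump_measurable:
  assumes "1 \<le> n"
  shows "\<sigma> z n \<in> borel_measurable M" "jump_size (z, n) \<in> borel_measurable M"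
  using mark_time_measurable[of "(z, n)"] jump_size_measurable[of "(z, n)"] assms
    measurable_environment_imp_measurable
  by (auto simp: marks_iff mark_time_def[abs_def])

lemma state_jumps_measurable: "state_jumps z r \<in> borel_measurable M"
proof -
  note [measurable] = mark_jump_measurable
  have "(\<lambda>\<omega>. \<integral>\<^sup>+n. (if \<sigma> z n \<omega> \<le> r then jump_size (z, n) \<omega> else 0) \<partial>count_space {1..})
      \<in> borel_measurable M"
    by (intro borel_measurable_nn_integral_count_space) auto
  then show ?thesis
    by (subst measurable_cong[OF state_jumps_eq]) simp_all
qed

text \<open>
  The mark \<open>\<sigma>\<^sup>z\<^sub>n\<close> and the holding time \<open>T\<^sup>z\<^sub>n\<close> are independent, and the latter has mean \<open>1\<close>.
\<close>

lemma expected_jump_before: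
  assumes n: "1 \<le> n"
  shows "(\<integral>\<^sup>+\<omega>. (if \<sigma> z n \<omega> \<le> r then jump_size (z, n) \<omega> else 0) \<partial>M)
       = ennreal (\<gamma> z) * (\<integral>\<^sup>+\<omega>. (if \<sigma> z n \<omega> \<le> r then 1 else 0) \<partial>M)"
proof -
  have zn: "(z, n) \<in> marks" using n by (simp add: marks_iff)
  have \<sigma>: "\<sigma> z n \<in> borel_measurable path_events"
    using mark_time_measurable_path_events[OF zn] by (simp add: mark_time_def[abs_def])
  have T: "T z n \<in> borel_measurable holding_events"
    using holding_measurable_holding_events[OF zn] by simp
  have path: "(\<lambda>\<omega>. \<omega>) \<in> measurable M path_events"
    using measurable_ident[of path_events] unfolding id_def
    by (rule subsetD[OF measurable_mono[OF subset_refl refl sets_path_events_subset], rotated]) simp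
  have "T z n \<in> borel_measurable environment"
    using T by (rule subsetD[OF measurable_mono[OF subset_refl refl holding_events_in_environment], rotated]) simp
  then have T': "T z n \<in> borel_measurable M"
    by (rule measurable_environment_imp_measurable)
  have "(\<integral>\<^sup>+\<omega>. (if \<sigma> z n \<omega> \<le> r then jump_size (z, n) \<omega> else 0) \<partial>M)
      = (\<integral>\<^sup>+\<omega>. (if \<sigma> z n \<omega> \<le> r then 1 else 0) * ennreal (\<gamma> z * T z n \<omega>) \<partial>M)"
    by (intro nn_integral_cong) (simp add: jump_size_def)
  also have "\<dots> = (\<integral>\<^sup>+\<omega>. (if \<sigma> z n \<omega> \<le> r then 1 else 0) \<partial>M) * (\<integral>\<^sup>+\<omega>. ennreal (\<gamma> z * T z n \<omega>) \<partial>M)"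
  proof (rule nn_integral_mult_independent[OF path T'])
    fix A and B :: "real set" assume A: "A \<in> sets path_events" and B: "B \<in> sets borel"
    have "T z n -` B \<inter> space M \<in> sets all_holding_events"
      using measurable_sets[OF T B] sets_holding_events_subset by auto
    moreover have "(\<lambda>\<omega>. \<omega>) -` A \<inter> space M = A"
      using sets.sets_into_space[OF A] by auto
    ultimately show "prob (((\<lambda>\<omega>. \<omega>) -` A \<inter> space M) \<inter> (T z n -` B \<inter> space M))
      = prob ((\<lambda>\<omega>. \<omega>) -` A \<inter> space M) * prob (T z n -` B \<inter> space M)"
      using prob_path_holding[OF A] by simp
  next
    note \<sigma> [measurable]
    show "(\<lambda>\<omega>. if \<sigma> z n \<omega> \<le> r then 1 else 0 :: ennreal) \<in> borel_measurable path_events"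
      by measurable
    show "(\<lambda>u. ennreal (\<gamma> z * u)) \<in> borel_measurable borel"
      by measurable
  qed
  also have "(\<integral>\<^sup>+\<omega>. ennreal (\<gamma> z * T z n \<omega>) \<partial>M) = ennreal (\<gamma> z)"
    using expected_jump_size[OF zn] by (simp add: jump_size_def)
  finally show ?thesis by (simp add: mult.commute)
qed

text \<open>
  Wald's identity: the number of jumps has mean \<open>\<lambda>\<^sub>z r\<close>, each jump has mean \<open>\<gamma>\<^sub>z\<close>, and the number
  of jumps is independent of their sizes.
\<close>

lemma expected_state_jumps:
  assumes "0 < r"
  shows "(\<integral>\<^sup>+\<omega>. state_jumps z r \<omega> \<partial>M) = ennreal (rate z * \<gamma> z * r)"
proof -
  note [measurable] = mark_jump_measurable
  have "(\<integral>\<^sup>+\<omega>. state_jumps z r \<omega> \<partial>M)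
      = (\<integral>\<^sup>+\<omega>. (\<integral>\<^sup>+n. (if \<sigma> z n \<omega> \<le> r then jump_size (z, n) \<omega> else 0) \<partial>count_space {1..}) \<partial>M)"
    by (intro nn_integral_cong state_jumps_eq)
  also have "\<dots> = (\<integral>\<^sup>+n. (\<integral>\<^sup>+\<omega>. (if \<sigma> z n \<omega> \<le> r then jump_size (z, n) \<omega> else 0) \<partial>M) \<partial>count_space {1..})"
    by (intro nn_integral_count_space_nn_integral) auto
  also have "\<dots> = (\<integral>\<^sup>+n. ennreal (\<gamma> z) * (\<integral>\<^sup>+\<omega>. (if \<sigma> z n \<omega> \<le> r then 1 else 0) \<partial>M) \<partial>count_space {1..})"
    by (intro nn_integral_cong expected_jump_before) simp
  also have "\<dots> = ennreal (\<gamma> z) * (\<integral>\<^sup>+n. (\<integral>\<^sup>+\<omega>. (if \<sigma> z n \<omega> \<le> r then 1 else 0) \<partial>M) \<partial>count_space {1..})"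
    by (intro nn_integral_cmult) simp
  also have "(\<integral>\<^sup>+n. (\<integral>\<^sup>+\<omega>. (if \<sigma> z n \<omega> \<le> r then 1 else 0) \<partial>M) \<partial>count_space {1..})
      = (\<integral>\<^sup>+\<omega>. (\<integral>\<^sup>+n. (if \<sigma> z n \<omega> \<le> r then 1 else 0) \<partial>count_space {1..}) \<partial>M)"
    by (intro nn_integral_count_space_nn_integral[symmetric]) auto
  also have "\<dots> = (\<integral>\<^sup>+\<omega>. of_nat (mark_count (\<sigma> z) r \<omega>) \<partial>M)"
    by (intro nn_integral_cong) (subst sum_upto_mark_count, auto)
  also have "\<dots> = ennreal (rate z * r)"
    by (rule expected_mark_count[OF assms])
  finally show ?thesis
    using gamma_pos[of z] by (simp add: ennreal_mult'[symmetric] mult_ac)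
qed

lemma rate_gamma_finite: "(\<integral>\<^sup>+z. ennreal (rate z * \<gamma> z) \<partial>count_space UNIV) < \<infinity>"
proof -
  have "(\<integral>\<^sup>+z. ennreal (rate z * \<gamma> z) \<partial>count_space UNIV) = (\<Sum>\<^sub>\<infinity>z\<in>UNIV. ennreal (rate z * \<gamma> z))"
    by (rule nn_integral_count_space_eq_infsum[OF infinite_states])
  also have "\<dots> = (SUP F\<in>{F. finite F \<and> F \<subseteq> UNIV}. \<Sum>z\<in>F. ennreal (rate z * \<gamma> z))"
    by (rule nonneg_infsum_complete) simp
  also have "\<dots> \<le> ennreal (\<Sum>\<^sub>\<infinity>z\<in>UNIV. rate z * \<gamma> z)"
  proof (rule SUP_least)
    fix F :: "'s set" assume "F \<in> {F. finite F \<and> F \<subseteq> UNIV}"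
    then have F: "finite F" by simp
    have nonneg: "0 \<le> rate z * \<gamma> z" for z
      using rate_pos[of z] gamma_pos[of z] by simp
    then have "(\<Sum>z\<in>F. ennreal (rate z * \<gamma> z)) = ennreal (\<Sum>z\<in>F. rate z * \<gamma> z)"
      by (intro sum_ennreal)
    also have "\<dots> \<le> ennreal (\<Sum>\<^sub>\<infinity>z\<in>UNIV. rate z * \<gamma> z)"
      using nonneg F by (intro ennreal_leI finite_sum_le_infsum rate_gamma_summable) auto
    finally show "(\<Sum>z\<in>F. ennreal (rate z * \<gamma> z)) \<le> ennreal (\<Sum>\<^sub>\<infinity>z\<in>UNIV. rate z * \<gamma> z)" .
  qed
  finally show ?thesis by (rule le_less_trans) simp
qed

lemma jump_measure_finite_AE:
  assumes "0 < r"
  shows "AE \<omega> in M. emeasure (jump_measure \<omega>) {..r} < \<infinity>"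
proof -
  have "(\<integral>\<^sup>+\<omega>. emeasure (jump_measure \<omega>) {..r} \<partial>M)
      = (\<integral>\<^sup>+\<omega>. (\<integral>\<^sup>+z. state_jumps z r \<omega> \<partial>count_space UNIV) \<partial>M)"
    by (intro nn_integral_cong jump_measure_atMost_eq)
  also have "\<dots> = (\<integral>\<^sup>+z. (\<integral>\<^sup>+\<omega>. state_jumps z r \<omega> \<partial>M) \<partial>count_space UNIV)"
    by (intro nn_integral_count_space_nn_integral state_jumps_measurable) auto
  also have "\<dots> = (\<integral>\<^sup>+z. ennreal r * ennreal (rate z * \<gamma> z) \<partial>count_space UNIV)"
    using assms less_imp_le[OF rate_pos] less_imp_le[OF gamma_pos]
    by (intro nn_integral_cong) (simp add: expected_state_jumps mult_ac flip: ennreal_mult)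
  also have "\<dots> = ennreal r * (\<integral>\<^sup>+z. ennreal (rate z * \<gamma> z) \<partial>count_space UNIV)"
    by (intro nn_integral_cmult) simp
  also have "\<dots> < \<infinity>"
    using rate_gamma_finite by (simp add: ennreal_mult_less_top)
  finally have "(\<integral>\<^sup>+\<omega>. emeasure (jump_measure \<omega>) {..r} \<partial>M) \<noteq> \<infinity>" by simp
  from nn_integral_PInf_AE[OF measurable_environment_imp_measurable[OF jump_measure_upto_measurable] this]
  show ?thesis by eventually_elim (simp add: less_top)
qed

section \<open>A clock without drift leaves no uncovered time\<close>

text \<open>
  The probability that \<open>n\<close> holding times of the state \<open>z\<close> sum up to at most \<open>a\<close> is given by the
  distribution function of an Erlang law and vanishes as \<open>n\<close> grows.
\<close>

lemma holding_sum_unbounded_AE: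
  "AE \<omega> in M. \<forall>a. \<exists>n. a < (\<Sum>i = 1..n. T z i \<omega>)"
proof -
  let ?X = "\<lambda>n \<omega>. \<Sum>i = 1..n. T z i \<omega>"
  have le: "prob {\<omega> \<in> space M. ?X (Suc n) \<omega> \<le> a} = erlang_CDF n 1 a" if "0 \<le> a" for n a
  proof -
    let ?I = "(\<lambda>i. Some (z, i)) ` {1..Suc n}"
    have inj: "inj_on (\<lambda>i. Some (z, i)) {1..Suc n}" by (auto simp: inj_on_def)
    have "distributed M lborel (\<lambda>\<omega>. \<Sum>j\<in>?I. exp_family T0 T j \<omega>) (erlang_density (card ?I - 1) 1)"
    proof (rule exponential_distributed_sum)
      show "indep_vars (\<lambda>j. borel) (exp_family T0 T) ?I"
        by (rule indep_vars_subset[OF exp_indep]) (auto simp: exp_index_def)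
      show "distributed M lborel (exp_family T0 T j) (exponential_density 1)" if "j \<in> ?I" for j
        by (rule exp_distributed) (use that in \<open>auto simp: exp_index_def\<close>)
    qed auto
    moreover have "(\<Sum>j\<in>?I. exp_family T0 T j \<omega>) = ?X (Suc n) \<omega>" for \<omega>
      by (subst sum.reindex[OF inj]) (simp add: exp_family_def)
    moreover have "card ?I = Suc n" using card_image[OF inj] by simp
    ultimately have "distributed M lborel (?X (Suc n)) (erlang_density n 1)" by simp
    from erlang_distributed_le[OF this _ that] show ?thesis by simp
  qed
  have meas: "?X n \<in> borel_measurable M" for n
  proof (intro borel_measurable_sum)
    fix i assume "i \<in> {1..n}"
    then have "distributed M lborel (T z i) (exponential_density 1)"
      using exp_distributed[of "Some (z, i)"] by (simp add: exp_index_def exp_family_def)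
    from distributed_measurable[OF this] show "T z i \<in> borel_measurable M" by simp
  qed
  have "AE \<omega> in M. \<exists>n. real a < ?X n \<omega>" for a :: nat
  proof -
    let ?B = "{\<omega> \<in> space M. \<forall>n. ?X n \<omega> \<le> real a}"
    note [measurable] = meas
    have B: "?B \<in> events" by measurable
    have "prob ?B \<le> erlang_CDF n 1 (real a)" for n
      unfolding le[OF of_nat_0_le_iff, symmetric]
    proof (rule finite_measure_mono)
      show "?B \<subseteq> {\<omega> \<in> space M. ?X (Suc n) \<omega> \<le> real a}" by blast
      show "{\<omega> \<in> space M. ?X (Suc n) \<omega> \<le> real a} \<in> events"
        using meas[of "Suc n"] by (rule borel_measurable_le) simp
    qed
    then have "prob ?B \<le> 0"
      by (intro LIMSEQ_le_const[OF erlang_CDF_tendsto_0[OF of_nat_0_le_iff[of a]]]) auto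
    then have "prob ?B = 0" using measure_nonneg[of M ?B] by linarith
    then have "AE \<omega> in M. \<not> (\<forall>n. ?X n \<omega> \<le> real a)"
      using B by (simp add: prob_eq_0)
    then show ?thesis by eventually_elim (simp add: not_le)
  qed
  then have "AE \<omega> in M. \<forall>a::nat. \<exists>n. real a < ?X n \<omega>"
    by (simp add: AE_all_countable)
  then show ?thesis
  proof eventually_elim
    case (elim \<omega>)
    show ?case
    proof
      fix a
      obtain k :: nat where "a < real k" using reals_Archimedean2 by blast
      with elim show "\<exists>n. a < ?X n \<omega>" by (meson less_trans)
    qed
  qed
qed

text \<open>
  Once the first \<open>n\<close> marks of \<open>z\<close> have passed, the clock is at least \<open>\<gamma>\<^sub>z\<close> times the sum of the
  first \<open>n\<close> holding times of \<open>z\<close>.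
\<close>

lemma base_clock_unbounded:
  assumes \<omega>: "\<omega> \<in> space M" and unbounded: "\<forall>a. \<exists>n. a < (\<Sum>i = 1..n. T z i \<omega>)"
  shows "\<exists>k::nat. ennreal t < base_clock (real k) \<omega>"
proof -
  obtain n where n: "max 0 (t / \<gamma> z) < (\<Sum>i = 1..n. T z i \<omega>)" using unbounded by blast
  then have "max 0 t < \<gamma> z * (\<Sum>i = 1..n. T z i \<omega>)"
    using gamma_pos[of z] by (auto simp: field_simps)
  have "n \<noteq> 0" using n by (intro notI) simp
  obtain k :: nat where k: "\<sigma> z n \<omega> \<le> real k" using real_arch_simple by blast
  have "ennreal t < ennreal (\<gamma> z * (\<Sum>i = 1..n. T z i \<omega>))"
    using \<open>max 0 t < _\<close> by (intro ennreal_lessI) auto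
  also have "\<dots> = ennreal (\<Sum>i = 1..n. \<gamma> z * T z i \<omega>)" by (simp add: sum_distrib_left)
  also have "\<dots> \<le> (\<Sum>i = 1..n. jump_size (z, i) \<omega>)"
    unfolding jump_size_def fst_conv snd_conv by (rule ennreal_sum_le)
  also have "\<dots> \<le> state_jumps z (real k) \<omega>"
    unfolding state_jumps_def using mark_le_iff[OF \<omega>, of n z "real k"] k \<open>n \<noteq> 0\<close>
    by (intro sum_mono2) auto
  also have "\<dots> = (\<integral>\<^sup>+z'. state_jumps z' (real k) \<omega> * indicator {z} z' \<partial>count_space UNIV)"
    by simp
  also have "\<dots> \<le> (\<integral>\<^sup>+z'. state_jumps z' (real k) \<omega> \<partial>count_space UNIV)"
    by (intro nn_integral_mono) (simp split: split_indicator)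
  also have "\<dots> \<le> base_clock (real k) \<omega>"
    unfolding base_clock_def jump_measure_atMost_eq[OF \<omega>] by simp
  finally show ?thesis by blast
qed

lemma expected_unvisited_time_eq_0:
  assumes "c = 0"
  shows "(\<integral>\<^sup>+\<omega>. unvisited_time t \<omega> \<partial>M) = 0"
proof -
  obtain z :: 's where True by blast
  have "AE \<omega> in M. \<forall>k::nat. emeasure (jump_measure \<omega>) {..real (Suc k)} < \<infinity>"
    unfolding AE_all_countable by (intro allI jump_measure_finite_AE) simp
  then have "AE \<omega> in M. unvisited_time t \<omega> = 0"
    using holding_sum_unbounded_AE[of z] AE_space
  proof eventually_elim
    case (elim \<omega>)
    obtain k :: nat where k: "ennreal t < base_clock (real k) \<omega>"
      using base_clock_unbounded[OF elim(3) elim(2)] by blast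
    have "emeasure (jump_measure \<omega>) {..real k} \<le> emeasure (jump_measure \<omega>) {..real (Suc k)}"
      by (intro emeasure_mono) auto
    also have "\<dots> < \<infinity>" using elim(1) by blast
    finally show ?case
      using k elim(3) assms by (intro unvisited_time_eq_0[of \<omega> "real k"]) auto
  qed
  then have "(\<integral>\<^sup>+\<omega>. unvisited_time t \<omega> \<partial>M) = (\<integral>\<^sup>+\<omega>. 0 \<partial>M)"
    by (rule nn_integral_cong_AE)
  then show ?thesis by simp
qed

section \<open>A clock with positive drift leaves nearly all of a short time uncovered\<close>

text \<open>
  If \<open>A(r) > d r\<close>, the numbers \<open>A\<^sub>z / (d r)\<close>, with \<open>A\<^sub>z\<close> the total jump of \<open>z\<close> up to \<open>r\<close>, have a
  sum of at least \<open>1\<close>. By \<open>one_le_sum_min\<close> this remains true if each of them is capped by the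
  number of marks of \<open>z\<close>, a positive integer unless \<open>A\<^sub>z = 0\<close>. The mean of the sum of the capped
  numbers therefore bounds the probability, and each capped number has a mean of at most the
  smaller one of the two means.
\<close>

lemma prob_large_jumps_le:
  assumes r: "0 < r" and d: "0 < d"
  shows "emeasure M {\<omega> \<in> space M. ennreal (d * r) < emeasure (jump_measure \<omega>) {..r}}
    \<le> (\<integral>\<^sup>+z. min (ennreal (rate z * r)) (ennreal (rate z * \<gamma> z / d)) \<partial>count_space UNIV)"
proof -
  let ?E = "{\<omega> \<in> space M. ennreal (d * r) < emeasure (jump_measure \<omega>) {..r}}"
  let ?A = "\<lambda>z \<omega>. ennreal (1 / (d * r)) * state_jumps z r \<omega>"
  let ?N = "\<lambda>z \<omega>. of_nat (mark_count (\<sigma> z) r \<omega>) :: ennreal"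
  note [measurable] = state_jumps_measurable
    measurable_environment_imp_measurable[OF jump_measure_upto_measurable]
  have N [measurable]: "?N z \<in> borel_measurable M" for z
    by (rule measurable_compose[OF mark_count_measurable]) (use r in auto)
  have "emeasure M ?E = (\<integral>\<^sup>+\<omega>. indicator ?E \<omega> \<partial>M)" by simp
  also have "\<dots> \<le> (\<integral>\<^sup>+\<omega>. (\<integral>\<^sup>+z. min (?N z \<omega>) (?A z \<omega>) \<partial>count_space UNIV) \<partial>M)"
  proof (intro nn_integral_mono)
    fix \<omega> assume \<omega>: "\<omega> \<in> space M"
    show "indicator ?E \<omega> \<le> (\<integral>\<^sup>+z. min (?N z \<omega>) (?A z \<omega>) \<partial>count_space UNIV)"
    proof (cases "\<omega> \<in> ?E")
      case True
      have "1 = ennreal (1 / (d * r)) * ennreal (d * r)"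
        using r d by (simp flip: ennreal_mult)
      also have "\<dots> \<le> ennreal (1 / (d * r)) * (\<integral>\<^sup>+z. state_jumps z r \<omega> \<partial>count_space UNIV)"
        using True jump_measure_atMost_eq[OF \<omega>, of r] by (intro mult_left_mono) auto
      also have "\<dots> = (\<integral>\<^sup>+z. ?A z \<omega> \<partial>count_space UNIV)"
        by (intro nn_integral_cmult[symmetric]) simp
      finally have "1 \<le> (\<integral>\<^sup>+z. ?A z \<omega> \<partial>count_space UNIV)" .
      moreover have "1 \<le> ?N z \<omega>" if "?A z \<omega> \<noteq> 0" for z
      proof -
        have "mark_count (\<sigma> z) r \<omega> \<noteq> 0" using that by (auto simp: state_jumps_def)
        then have "of_nat 1 \<le> ?N z \<omega>" by (intro of_nat_mono) simp
        then show ?thesis by simp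
      qed
      ultimately have "1 \<le> (\<integral>\<^sup>+z. min (?N z \<omega>) (?A z \<omega>) \<partial>count_space UNIV)"
        by (rule one_le_sum_min)
      then show ?thesis using True by simp
    qed simp
  qed
  also have "\<dots> = (\<integral>\<^sup>+z. (\<integral>\<^sup>+\<omega>. min (?N z \<omega>) (?A z \<omega>) \<partial>M) \<partial>count_space UNIV)"
    by (intro nn_integral_count_space_nn_integral) auto
  also have "\<dots> \<le> (\<integral>\<^sup>+z. min (ennreal (rate z * r)) (ennreal (rate z * \<gamma> z / d)) \<partial>count_space UNIV)"
  proof (intro nn_integral_mono min.boundedI)
    fix z
    have "(\<integral>\<^sup>+\<omega>. min (?N z \<omega>) (?A z \<omega>) \<partial>M) \<le> (\<integral>\<^sup>+\<omega>. ?N z \<omega> \<partial>M)"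
      by (intro nn_integral_mono) simp
    then show "(\<integral>\<^sup>+\<omega>. min (?N z \<omega>) (?A z \<omega>) \<partial>M) \<le> ennreal (rate z * r)"
      by (simp add: expected_mark_count[OF r])
    have "(\<integral>\<^sup>+\<omega>. min (?N z \<omega>) (?A z \<omega>) \<partial>M) \<le> (\<integral>\<^sup>+\<omega>. ?A z \<omega> \<partial>M)"
      by (intro nn_integral_mono) simp
    also have "\<dots> = ennreal (1 / (d * r)) * ennreal (rate z * \<gamma> z * r)"
      by (simp add: nn_integral_cmult expected_state_jumps[OF r])
    also have "\<dots> = ennreal (rate z * \<gamma> z / d)"
      using r d rate_pos[of z] gamma_pos[of z] by (simp flip: ennreal_mult)
    finally show "(\<integral>\<^sup>+\<omega>. min (?N z \<omega>) (?A z \<omega>) \<partial>M) \<le> ennreal (rate z * \<gamma> z / d)" .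
  qed
  finally show ?thesis .
qed

text \<open>
  The jump part of the clock is \<open>o(r)\<close> in probability although its mean is proportional to \<open>r\<close>:
  the mean is carried by jumps that are too rare to occur up to a small time \<open>r\<close>.
\<close>

lemma prob_large_jumps_tendsto_0:
  assumes d: "0 < d"
  shows "((\<lambda>r. prob {\<omega> \<in> space M. ennreal (d * r) < emeasure (jump_measure \<omega>) {..r}}) \<longlongrightarrow> 0) (at_right 0)"
proof -
  let ?p = "\<lambda>r. {\<omega> \<in> space M. ennreal (d * r) < emeasure (jump_measure \<omega>) {..r}}"
  have "(\<integral>\<^sup>+z. ennreal (rate z * \<gamma> z / d) \<partial>count_space UNIV)
      = ennreal (1 / d) * (\<integral>\<^sup>+z. ennreal (rate z * \<gamma> z) \<partial>count_space UNIV)"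
    using d by (subst nn_integral_cmult[symmetric]) (auto simp: ennreal_mult'[symmetric])
  then have "(\<integral>\<^sup>+z. ennreal (rate z * \<gamma> z / d) \<partial>count_space UNIV) < \<infinity>"
    using rate_gamma_finite by (simp add: ennreal_mult_less_top)
  note bound = nn_integral_min_tendsto_0[OF this, of rate]
  have "((\<lambda>r. emeasure M (?p r)) \<longlongrightarrow> 0) (at_right 0)"
  proof (rule tendsto_sandwich[OF _ _ tendsto_const bound])
    show "\<forall>\<^sub>F r in at_right 0. emeasure M (?p r)
        \<le> (\<integral>\<^sup>+z. min (ennreal (rate z * r)) (ennreal (rate z * \<gamma> z / d)) \<partial>count_space UNIV)"
      using prob_large_jumps_le[OF _ d] by (auto simp: eventually_at_right_field intro!: exI[of _ 1])
  qed simp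
  then have "((\<lambda>r. ennreal (prob (?p r))) \<longlongrightarrow> ennreal 0) (at_right 0)"
    by (simp add: emeasure_eq_measure)
  then show ?thesis by (rule tendsto_ennrealD) auto
qed

text \<open>
  When the jumps up to \<open>r\<close> contribute at most \<open>d r = (1 - \<theta>) t\<close>, the clock at \<open>r\<close> has not passed
  \<open>d r + c r = t\<close>, and below it a set of measure \<open>c r = \<theta> t\<close> is uncovered.
\<close>

lemma expected_unvisited_time_ge:
  assumes c: "0 < c" and \<theta>: "0 < \<theta>" "\<theta> < 1" and t: "0 < t"
  defines "r \<equiv> \<theta> * t / c" and "d \<equiv> (1 - \<theta>) * c / \<theta>"
  shows "ennreal (\<theta> * t * (1 - prob {\<omega> \<in> space M. ennreal (d * r) < emeasure (jump_measure \<omega>) {..r}}))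
     \<le> (\<integral>\<^sup>+\<omega>. unvisited_time t \<omega> \<partial>M)"
proof -
  let ?E = "{\<omega> \<in> space M. ennreal (d * r) < emeasure (jump_measure \<omega>) {..r}}"
  note [measurable] = measurable_environment_imp_measurable[OF jump_measure_upto_measurable]
  have E: "?E \<in> events" by measurable
  have r: "0 \<le> r" "c * r = \<theta> * t" using c \<theta> t by (auto simp: r_def)
  have d: "0 \<le> d * r" "d * r = (1 - \<theta>) * t" using c \<theta> t by (auto simp: r_def d_def)
  have "1 - prob ?E = prob (space M - ?E)"
    using prob_compl[OF E] by simp
  then have "ennreal (\<theta> * t * (1 - prob ?E)) = ennreal (\<theta> * t) * emeasure M (space M - ?E)"
    using \<theta> t by (simp add: emeasure_eq_measure ennreal_mult)
  also have "\<dots> = (\<integral>\<^sup>+\<omega>. ennreal (\<theta> * t) * indicator (space M - ?E) \<omega> \<partial>M)"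
    using E by (subst nn_integral_cmult_indicator) auto
  also have "\<dots> \<le> (\<integral>\<^sup>+\<omega>. unvisited_time t \<omega> \<partial>M)"
  proof (intro nn_integral_mono)
    fix \<omega> assume \<omega>: "\<omega> \<in> space M"
    show "ennreal (\<theta> * t) * indicator (space M - ?E) \<omega> \<le> unvisited_time t \<omega>"
    proof (cases "\<omega> \<in> ?E")
      case False
      then have "base_clock r \<omega> \<le> ennreal (d * r) + ennreal (c * r)"
        using \<omega> unfolding base_clock_def by (intro add_right_mono) (simp add: not_less)
      also have "\<dots> = ennreal t"
        unfolding d(2) r(2) using \<theta> t
        by (subst ennreal_plus[symmetric]) (auto simp: algebra_simps)
      finally show ?thesis
        using unvisited_time_ge[OF \<omega> r(1)] r(2) \<omega> False by simp
    qed simp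
  qed
  finally show ?thesis .
qed

lemma unvisited_time_le: "unvisited_time t \<omega> \<le> ennreal t"
proof (cases "0 \<le> t")
  case True
  have "unvisited_time t \<omega> \<le> emeasure lborel {0..t}"
    unfolding unvisited_time_def by (intro emeasure_mono) auto
  with True show ?thesis by simp
qed (simp add: unvisited_time_def)

section \<open>The transition rate to infinity\<close>

lemma transition_prob_eq:
  "ennreal (transition_prob M \<gamma> c \<sigma> T0 T (Some x) None t)
     = emeasure M {\<omega> \<in> space M. K_process \<gamma> c \<sigma> T0 T (Some x) t \<omega> = None}"
  by (simp add: transition_prob_def emeasure_eq_measure)

lemma transition_rate_to_infinity:
  "((\<lambda>t. transition_prob M \<gamma> c \<sigma> T0 T (Some x) None t / t)
     \<longlongrightarrow> (if c > 0 then 1 / \<gamma> x else 0)) (at_right 0)"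
proof (cases "c > 0")
  case False
  then have "c = 0" using c_nonneg by simp
  have "transition_prob M \<gamma> c \<sigma> T0 T (Some x) None t = 0" for t
  proof -
    have "ennreal (transition_prob M \<gamma> c \<sigma> T0 T (Some x) None t) \<le> 0"
      using None_probability_bounds(1)[of x t]
      by (simp add: transition_prob_eq expected_unvisited_time_eq_0[OF \<open>c = 0\<close>])
    then show ?thesis by (simp add: ennreal_eq_0_iff transition_prob_def measure_le_0_iff)
  qed
  then show ?thesis using False by simp
next
  case c: True
  let ?p = "\<lambda>t. transition_prob M \<gamma> c \<sigma> T0 T (Some x) None t"
  have g: "0 < \<gamma> x" by (rule gamma_pos)
  have upper: "?p t / t \<le> 1 / \<gamma> x" if t: "0 < t" for t
  proof -
    have "(\<integral>\<^sup>+\<omega>. unvisited_time t \<omega> \<partial>M) \<le> (\<integral>\<^sup>+\<omega>. ennreal t \<partial>M)"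
      by (intro nn_integral_mono unvisited_time_le)
    also have "\<dots> = ennreal t" by (simp add: emeasure_space_1)
    finally have "ennreal (1 / \<gamma> x) * (\<integral>\<^sup>+\<omega>. unvisited_time t \<omega> \<partial>M) \<le> ennreal (1 / \<gamma> x) * ennreal t"
      by (intro mult_left_mono) simp_all
    with None_probability_bounds(1)[of x t]
    have "ennreal (?p t) \<le> ennreal (1 / \<gamma> x) * ennreal t"
      unfolding transition_prob_eq by (rule order_trans)
    then have "ennreal (?p t) \<le> ennreal (1 / \<gamma> x * t)"
      using g t by (subst ennreal_mult) auto
    then have "?p t \<le> 1 / \<gamma> x * t"
      using g t by (subst (asm) ennreal_le_iff) auto
    then show ?thesis
      using t by (simp add: divide_le_eq)
  qed
  have lower: "\<forall>\<^sub>F t in at_right 0. a < ?p t / t" if a: "a < 1 / \<gamma> x" for a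
  proof -
    \<comment> \<open>The lower bound below tends to \<open>\<theta> / \<gamma>\<^sub>x\<close>, so \<open>\<theta>\<close> is chosen to make this exceed \<open>a\<close>.\<close>
    obtain \<theta> where \<theta>: "max 0 (a * \<gamma> x) < \<theta>" "\<theta> < 1"
      using a g dense[of "max 0 (a * \<gamma> x)" 1] by (auto simp: field_simps)
    define d where "d = (1 - \<theta>) * c / \<theta>"
    define h where "h r = prob {\<omega> \<in> space M. ennreal (d * r) < emeasure (jump_measure \<omega>) {..r}}" for r
    let ?L = "\<lambda>t. exp (- t / \<gamma> x) / \<gamma> x * (\<theta> * (1 - h (\<theta> * t / c)))"
    have ge: "?L t \<le> ?p t / t" if t: "0 < t" for t
    proof -
      have "ennreal (exp (- t / \<gamma> x) / \<gamma> x * (\<theta> * t * (1 - h (\<theta> * t / c))))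
          = ennreal (exp (- t / \<gamma> x) / \<gamma> x) * ennreal (\<theta> * t * (1 - h (\<theta> * t / c)))"
        using g by (intro ennreal_mult') simp
      also have "\<dots> \<le> ennreal (exp (- t / \<gamma> x) / \<gamma> x) * (\<integral>\<^sup>+\<omega>. unvisited_time t \<omega> \<partial>M)"
        using expected_unvisited_time_ge[OF c _ \<theta>(2) t] \<theta>(1)
        by (intro mult_left_mono) (auto simp: h_def d_def)
      also have "\<dots> \<le> ennreal (?p t)"
        unfolding transition_prob_eq by (rule None_probability_bounds)
      finally have "exp (- t / \<gamma> x) / \<gamma> x * (\<theta> * t * (1 - h (\<theta> * t / c))) \<le> ?p t"
        by (subst (asm) ennreal_le_iff) (simp add: transition_prob_def)
      then show ?thesis using t by (simp add: field_simps)
    qed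
    have "d > 0" using \<theta> c by (simp add: d_def)
    have "filterlim (\<lambda>t. \<theta> * t / c) (at_right 0) (at_right 0)"
      using \<theta>(1) c unfolding filterlim_at
      by (auto intro!: tendsto_eq_intros simp: eventually_at_right_field intro!: exI[of _ 1])
    then have "((\<lambda>t. h (\<theta> * t / c)) \<longlongrightarrow> 0) (at_right 0)"
      using prob_large_jumps_tendsto_0[OF \<open>d > 0\<close>] unfolding h_def by (rule filterlim_compose[rotated])
    then have "(?L \<longlongrightarrow> exp (- 0 / \<gamma> x) / \<gamma> x * (\<theta> * (1 - 0))) (at_right 0)"
      using g by (intro tendsto_intros) auto
    moreover have "a < exp (- 0 / \<gamma> x) / \<gamma> x * (\<theta> * (1 - 0))"
      using \<theta>(1) g by (simp add: field_simps)
    ultimately have "\<forall>\<^sub>F t in at_right 0. a < ?L t" by (rule order_tendstoD)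
    moreover have "\<forall>\<^sub>F t in at_right 0. 0 < (t::real)"
      by (rule eventually_at_right_less)
    ultimately show ?thesis
      by eventually_elim (use ge in \<open>blast intro: less_le_trans\<close>)
  qed
  have "((\<lambda>t. ?p t / t) \<longlongrightarrow> 1 / \<gamma> x) (at_right 0)"
  proof (rule order_tendstoI)
    fix b assume "1 / \<gamma> x < b"
    then show "\<forall>\<^sub>F t in at_right 0. ?p t / t < b"
      using eventually_at_right_less[of "0::real"] upper
      by (auto elim!: eventually_mono intro: le_less_trans)
  qed (rule lower)
  then show ?thesis using c by simp
qed

end

theorem proposition5p7:
  fixes M :: "'w measure"
    and \<gamma> rate :: "'s::countable \<Rightarrow> real" and c :: real
    and \<sigma> :: "'s \<Rightarrow> nat \<Rightarrow> 'w \<Rightarrow> real"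
    and T0 :: "'w \<Rightarrow> real" and T :: "'s \<Rightarrow> nat \<Rightarrow> 'w \<Rightarrow> real"
  assumes "K_process_data M \<gamma> rate c \<sigma> T0 T"
  shows "\<forall>x. ((\<lambda>t. transition_prob M \<gamma> c \<sigma> T0 T (Some x) None t / t)
                \<longlongrightarrow> (if c > 0 then 1 / \<gamma> x else 0)) (at_right 0)"
  using K_process_data.transition_rate_to_infinity[OF assms] by blast

end
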